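(* Let $q$ be a prime and let $\mathcal{S}$ be a stabilizer code with parameters $[[n,k,d]]_q$. Then $\mathcal{S}$ can be transformed into an analog continuous-variable code with parameters $[[n,k,d']]_{\mathbb{R}}$ (i.e. $n$ physical continuous modes, $k$ logical continuous modes, distance $d'$), where $d'=d^*\geq d$.
   Context: For prime $q$, qudit Paulis are generated by $X|j\rangle=|j+1 \bmod q\rangle$, $Z|j\rangle=e^{2\pi i j/q}|j\rangle$. An $n$-register Pauli $\bigotimes_t X^{a_t}Z^{b_t}$ has integer representation $\phi_\infty=(\vec a\,|\,\vec b)\in\mathbb{Z}^{2n}$; the symplectic product is $(\vec a|\vec b)\odot(\vec a'|\vec b')=\vec a\cdot\vec b'-\vec a'\cdot\vec b$. A stabilizer code $[[n,k,d]]_q$ has $n-k$ independent generators with pairwise symplectic products $\equiv 0 \pmod q$; its distance $d$ is the minimum weight (number of non-identity tensor factors) of a Pauli commuting with all stabilizers but not in the stabilizer group. A local-dimension-invariant (LDI) form of $\mathcal{S}$ is a set of integer generator vectors, congruent modulo $q$ to generators of $\mathcal{S}$, whose pairwise integer symplectic products are exactly $0$. An unavoidable error is a Pauli (not in the stabilizer group) whose integer symplectic product with every LDI generator is exactly $0$; $d^*$ is the minimal weight of an unavoidable error. The analog continuous-variable code associated to an LDI form has, for each generator $(\vec a|\vec b)$, the nullifier $\vec a\cdot\vec x+\vec b\cdot\vec p$, where $x_1,\dots,x_n,p_1,\dots,p_n$ are quadrature operators with $[x_k,p_l]=\delta_{kl}$ and $[x_k,x_l]=[p_k,p_l]=0$;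 errors are displacements (continuous-valued Paulis) on the modes and the distance is the minimal number of modes acted on by an undetectable error acting nontrivially on the code space. *)

theory Defs
  imports "HOL-Number_Theory.Number_Theory"
begin

text \<open>A (generalized) Pauli on n registers is represented by its exponent vectors
  (a | b), a pair of functions; only the indices t < n are relevant.\<close>

type_synonym 'a pvec = "(nat \<Rightarrow> 'a) \<times> (nat \<Rightarrow> 'a)"

definition sympl :: "nat \<Rightarrow> ('a::comm_ring) pvec \<Rightarrow> 'a pvec \<Rightarrow> 'a" where
  "sympl n u v = (\<Sum>t<n. fst u t * snd v t - fst v t * snd u t)"

definition wt :: "nat \<Rightarrow> ('a::zero) pvec \<Rightarrow> nat" where
  "wt n u = card {t. t < n \<and> (fst u t \<noteq> 0 \<or> snd u t \<noteq> 0)}"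

definition is_pauli :: "int \<Rightarrow> nat \<Rightarrow> int pvec \<Rightarrow> bool" where
  "is_pauli q n e \<longleftrightarrow> (\<forall>t<n. fst e t \<in> {0..<q} \<and> snd e t \<in> {0..<q})"

text \<open>Membership (up to phase) in the group generated mod q by the list G.\<close>
definition in_stab :: "int \<Rightarrow> nat \<Rightarrow> int pvec list \<Rightarrow> int pvec \<Rightarrow> bool" where
  "in_stab q n G e \<longleftrightarrow> (\<exists>c::nat \<Rightarrow> int. \<forall>t<n.
      [fst e t = (\<Sum>i<length G. c i * fst (G!i) t)] (mod q) \<and>
      [snd e t = (\<Sum>i<length G. c i * snd (G!i) t)] (mod q))"

definition indep_mod :: "int \<Rightarrow> nat \<Rightarrow> int pvec list \<Rightarrow> bool" where
  "indep_mod q n G \<longleftrightarrow> (\<forall>c::nat \<Rightarrow> int.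
      (\<forall>t<n. [(\<Sum>i<length G. c i * fst (G!i) t) = 0] (mod q) \<and>
             [(\<Sum>i<length G. c i * snd (G!i) t) = 0] (mod q))
      \<longrightarrow> (\<forall>i<length G. [c i = 0] (mod q)))"

definition is_stab_code :: "int \<Rightarrow> nat \<Rightarrow> nat \<Rightarrow> int pvec list \<Rightarrow> bool" where
  "is_stab_code q n k G \<longleftrightarrow> prime q \<and> k \<le> n \<and> length G = n - k \<and> indep_mod q n G \<and>
     (\<forall>g\<in>set G. \<forall>h\<in>set G. [sympl n g h = 0] (mod q))"

definition logical_q :: "int \<Rightarrow> nat \<Rightarrow> int pvec list \<Rightarrow> int pvec \<Rightarrow> bool" where
  "logical_q q n G e \<longleftrightarrow> is_pauli q n e \<and> (\<forall>g\<in>set G. [sympl n e g = 0] (mod q))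
      \<and> \<not> in_stab q n G e"

definition code_distance :: "int \<Rightarrow> nat \<Rightarrow> int pvec list \<Rightarrow> nat \<Rightarrow> bool" where
  "code_distance q n G d \<longleftrightarrow> (\<exists>e. logical_q q n G e \<and> wt n e = d) \<and>
      (\<forall>e. logical_q q n G e \<longrightarrow> d \<le> wt n e)"

text \<open>LDI form: integer generators congruent mod q to a generating set of S
  (same number of generators, same group mod q) with exactly vanishing symplectic products.\<close>
definition is_LDI_form :: "int \<Rightarrow> nat \<Rightarrow> int pvec list \<Rightarrow> int pvec list \<Rightarrow> bool" where
  "is_LDI_form q n G L \<longleftrightarrow> length L = length G \<and>
      (\<forall>e. in_stab q n L e \<longleftrightarrow> in_stab q n G e) \<and>
      (\<forall>g\<in>set L. \<forall>h\<in>set L. sympl n g h = 0)"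

definition unavoidable :: "int \<Rightarrow> nat \<Rightarrow> int pvec list \<Rightarrow> int pvec list \<Rightarrow> int pvec \<Rightarrow> bool" where
  "unavoidable q n G L e \<longleftrightarrow> is_pauli q n e \<and> \<not> in_stab q n G e \<and>
      (\<forall>l\<in>set L. sympl n e l = 0)"

definition unavoidable_distance :: "int \<Rightarrow> nat \<Rightarrow> int pvec list \<Rightarrow> int pvec list \<Rightarrow> nat \<Rightarrow> bool" where
  "unavoidable_distance q n G L d \<longleftrightarrow> (\<exists>e. unavoidable q n G L e \<and> wt n e = d) \<and>
      (\<forall>e. unavoidable q n G L e \<longrightarrow> d \<le> wt n e)"

text \<open>Analog continuous-variable code with nullifiers a.x + b.p for (a|b) in L.\<close>
definition rvec :: "int pvec \<Rightarrow> real pvec" where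
  "rvec u = (\<lambda>t. real_of_int (fst u t), \<lambda>t. real_of_int (snd u t))"

definition in_real_span :: "nat \<Rightarrow> int pvec list \<Rightarrow> real pvec \<Rightarrow> bool" where
  "in_real_span n L v \<longleftrightarrow> (\<exists>c::nat \<Rightarrow> real. \<forall>t<n.
      fst v t = (\<Sum>i<length L. c i * fst (rvec (L!i)) t) \<and>
      snd v t = (\<Sum>i<length L. c i * snd (rvec (L!i)) t))"

definition real_indep :: "nat \<Rightarrow> int pvec list \<Rightarrow> bool" where
  "real_indep n L \<longleftrightarrow> (\<forall>c::nat \<Rightarrow> real.
      (\<forall>t<n. (\<Sum>i<length L. c i * fst (rvec (L!i)) t) = 0 \<and>
             (\<Sum>i<length L. c i * snd (rvec (L!i)) t) = 0)
      \<longrightarrow> (\<forall>i<length L. c i = 0))"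

text \<open>Undetectable displacement acting nontrivially on the code space.\<close>
definition cv_logical :: "nat \<Rightarrow> int pvec list \<Rightarrow> real pvec \<Rightarrow> bool" where
  "cv_logical n L v \<longleftrightarrow> (\<forall>l\<in>set L. sympl n v (rvec l) = 0) \<and> \<not> in_real_span n L v"

definition cv_distance :: "nat \<Rightarrow> int pvec list \<Rightarrow> nat \<Rightarrow> bool" where
  "cv_distance n L d \<longleftrightarrow> (\<exists>v. cv_logical n L v \<and> wt n v = d) \<and>
      (\<forall>v. cv_logical n L v \<longrightarrow> d \<le> wt n v)"

text \<open>The CV code of L has parameters [[n,k,d']]_R: n modes, n-k independent
  (commuting) nullifiers, hence k logical modes, and distance d'.\<close>
definition cv_code_params :: "nat \<Rightarrow> nat \<Rightarrow> nat \<Rightarrow> int pvec list \<Rightarrow> bool" where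
  "cv_code_params n k d' L \<longleftrightarrow> k \<le> n \<and> length L = n - k \<and> real_indep n L \<and>
      (\<forall>g\<in>set L. \<forall>h\<in>set L. sympl n (rvec g) (rvec h) = 0) \<and> cv_distance n L d'"

end

theory Submission
  imports Defs
begin

text \<open>
  Fix a logical error e of minimal weight d. It suffices to lift the generators to an integer
  isotropic family L that is exactly orthogonal to e and whose continuous code has no undetectable
  nontrivial displacement of weight below d, for then e realises both distances.

  Independence modulo q gives dual vectors that are exact up to a factor prime to q, and
  projecting along them turns symplectic products divisible by q into exact zeros. Among all
  such lifts of (e, G) take one maximising the sum of the ranks of the restrictions of L to sets
  T of registers. If some T with |T| < d were of deficient rank, there would be
  v supported on T orthogonal to L and l in the span of L vanishing on T; neither is
  proportional to e, so some w orthogonal to e pairs nontrivially with both. The transvection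
  x + C om(x, w) w fixes e and raises the rank on T, and if C is divisible by q and by a
  large prime p it preserves the class modulo q and, by independence modulo p, lowers no other
  rank. So every such T has full rank 2|T|; there is room for this because of the quantum
  Singleton bound n - k >= 2(d - 1). Full rank on T excludes every nonzero displacement
  supported on T that is orthogonal to L.
\<close>

section \<open>Linear algebra modulo a prime or zero\<close>

text \<open>The modulus 0 is allowed on purpose: it gives linear algebra over the rationals.\<close>

definition prime_like :: "int \<Rightarrow> bool" where
  "prime_like q \<longleftrightarrow> \<not> q dvd 1 \<and> (\<forall>a b. q dvd a * b \<longrightarrow> q dvd a \<or> q dvd b)"

lemma prime_like_prime: "prime q \<Longrightarrow> prime_like q"
  by (auto simp: prime_like_def prime_dvd_mult_iff)

lemma prime_like_0: "prime_like 0"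
  by (auto simp: prime_like_def)

lemma prime_like_mult: "prime_like q \<Longrightarrow> q dvd a * b \<longleftrightarrow> q dvd a \<or> q dvd b"
  by (auto simp: prime_like_def)

section \<open>The integer pairing of coordinate vectors\<close>

definition dot :: "'u set \<Rightarrow> ('u \<Rightarrow> int) \<Rightarrow> ('u \<Rightarrow> int) \<Rightarrow> int" where
  "dot U x y = (\<Sum>u\<in>U. x u * y u)"

lemma dot_comm: "dot U x y = dot U y x"
  by (simp add: dot_def mult.commute)

lemma dot_scale_right: "dot U x (\<lambda>u. c * y u) = c * dot U x y"
  by (simp add: dot_def sum_distrib_left algebra_simps)

lemma dot_diff_right: "dot U x (\<lambda>u. y u - z u) = dot U x y - dot U x z"
  by (simp add: dot_def sum_subtractf algebra_simps)

lemma dot_add_right: "dot U x (\<lambda>u. y u + z u) = dot U x y + dot U x z"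
  by (simp add: dot_def sum.distrib algebra_simps)

lemma dot_sum_right: "dot U x (\<lambda>u. \<Sum>i\<in>I. c i * y i u) = (\<Sum>i\<in>I. c i * dot U x (y i))"
proof -
  have "dot U x (\<lambda>u. \<Sum>i\<in>I. c i * y i u) = (\<Sum>u\<in>U. \<Sum>i\<in>I. c i * (x u * y i u))"
    unfolding dot_def by (simp add: sum_distrib_left algebra_simps)
  also have "\<dots> = (\<Sum>i\<in>I. \<Sum>u\<in>U. c i * (x u * y i u))"
    by (rule sum.swap)
  finally show ?thesis by (simp add: dot_def sum_distrib_left)
qed

lemma dot_sum_left: "dot U (\<lambda>u. \<Sum>i\<in>I. c i * y i u) x = (\<Sum>i\<in>I. c i * dot U (y i) x)"
  by (simp add: dot_comm[of U _ x] dot_sum_right)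

lemma dot_scale_left: "dot U (\<lambda>u. c * y u) x = c * dot U y x"
  using dot_scale_right[of U x c y] by (simp add: dot_comm)

lemma dot_diff_left: "dot U (\<lambda>u. y u - z u) x = dot U y x - dot U z x"
  using dot_diff_right[of U x y z] by (simp add: dot_comm)

lemma dot_add_left: "dot U (\<lambda>u. y u + z u) x = dot U y x + dot U z x"
  using dot_add_right[of U x y z] by (simp add: dot_comm)

lemmas dot_linear = dot_scale_right dot_diff_right dot_add_right dot_sum_right
  dot_scale_left dot_diff_left dot_add_left dot_sum_left

lemma dvd_dot: "(\<And>u. u \<in> U \<Longrightarrow> q dvd x u) \<Longrightarrow> q dvd dot U x y"
  unfolding dot_def by (intro dvd_sum) auto

lemma dot_cong_mod:
  "(\<And>u. u \<in> U \<Longrightarrow> q dvd x u - x' u) \<Longrightarrow> q dvd dot U x y - dot U x' y"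
  using dvd_dot[of U q "\<lambda>u. x u - x' u" y] by (simp add: dot_diff_left)

lemma dot_cong: "(\<And>u. u \<in> U \<Longrightarrow> x u = x' u) \<Longrightarrow> dot U x y = dot U x' y"
  unfolding dot_def by (intro sum.cong) auto

lemma dot_unit: "finite U \<Longrightarrow> u \<in> U \<Longrightarrow> dot U x (\<lambda>v. if v = u then 1 else 0) = x u"
  by (simp add: dot_def if_distrib cong: if_cong)

lemma sum_mult_delta:
  fixes f :: "'i \<Rightarrow> int"
  assumes "finite I" "a \<in> I"
  shows "(\<Sum>b\<in>I. f b * (if a = b then N else 0)) = f a * N"
    and "(\<Sum>b\<in>I. f b * (if b = a then N else 0)) = f a * N"
  using assms by (simp_all add: if_distrib cong: if_cong)

section \<open>Linear independence and dual families\<close>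

definition indep :: "int \<Rightarrow> 'i set \<Rightarrow> 'u set \<Rightarrow> ('i \<Rightarrow> 'u \<Rightarrow> int) \<Rightarrow> bool" where
  "indep q I U A \<longleftrightarrow> (\<forall>c. (\<forall>u\<in>U. q dvd (\<Sum>i\<in>I. c i * A i u)) \<longrightarrow> (\<forall>i\<in>I. q dvd c i))"

lemma indepD:
  "indep q I U A \<Longrightarrow> (\<And>u. u \<in> U \<Longrightarrow> q dvd (\<Sum>i\<in>I. c i * A i u)) \<Longrightarrow> i \<in> I \<Longrightarrow> q dvd c i"
  unfolding indep_def by blast

lemma indep_subset:
  assumes "indep q I U A" "I' \<subseteq> I" "finite I"
  shows "indep q I' U A"
  unfolding indep_def
proof (intro allI impI ballI)
  fix c i assume c: "\<forall>u\<in>U. q dvd (\<Sum>i\<in>I'. c i * A i u)" and i: "i \<in> I'"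
  have "q dvd (if i \<in> I' then c i else 0)"
  proof (rule indepD[OF assms(1)])
    fix u assume u: "u \<in> U"
    have "(\<Sum>i\<in>I. (if i \<in> I' then c i else 0) * A i u) = (\<Sum>i\<in>I'. c i * A i u)"
      using assms by (intro sum.mono_neutral_cong_right) auto
    then show "q dvd (\<Sum>i\<in>I. (if i \<in> I' then c i else 0) * A i u)" using c u by simp
  qed (use i assms in auto)
  then show "q dvd c i" using i by simp
qed

definition dual_family ::
  "'i set \<Rightarrow> 'u set \<Rightarrow> ('i \<Rightarrow> 'u \<Rightarrow> int) \<Rightarrow> ('i \<Rightarrow> 'u \<Rightarrow> int) \<Rightarrow> int \<Rightarrow> bool" where
  "dual_family I U A F N \<longleftrightarrow>
     (\<forall>a\<in>I. \<forall>b\<in>I. dot U (A a) (F b) = (if a = b then N else 0))"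

text \<open>The scale factor N plays the role of the determinant in Cramer's rule.\<close>

lemma dual_of_indep:
  assumes "finite I" "finite U" "prime_like q" "indep q I U A"
  shows "\<exists>F N. \<not> q dvd N \<and> dual_family I U A F N"
  using assms(1,4)
proof (induction I rule: finite_induct)
  case empty
  then show ?case using assms(3) by (auto simp: prime_like_def dual_family_def intro!: exI[of _ 1])
next
  case (insert j I)
  have "indep q I U A" using indep_subset[OF insert.prems] insert.hyps by auto
  then obtain F N where N: "\<not> q dvd N"
    and F: "\<And>a b. a \<in> I \<Longrightarrow> b \<in> I \<Longrightarrow> dot U (A a) (F b) = (if a = b then N else 0)"
    using insert.IH unfolding dual_family_def by metis
  \<comment> \<open>Up to the factor \<open>N\<close>, this is what projecting away the rows in
    \<open>I\<close> leaves of row \<open>j\<close>. Were all its entries divisible by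
    \<open>q\<close>, it would be a relation with coefficient \<open>N\<close> at
    \<open>j\<close>.\<close>
  define r where "r = (\<lambda>u. N * A j u - (\<Sum>b\<in>I. dot U (A j) (F b) * A b u))"
  have "\<exists>u\<in>U. \<not> q dvd r u"
  proof (rule ccontr)
    assume *: "\<not> ?thesis"
    define c where "c = (\<lambda>i. if i = j then N else - dot U (A j) (F i))"
    have "q dvd c j"
    proof (rule indepD[OF insert.prems])
      fix u assume "u \<in> U"
      have "(\<Sum>i\<in>I. c i * A i u) = (\<Sum>i\<in>I. - dot U (A j) (F i) * A i u)"
        using insert.hyps by (intro sum.cong) (auto simp: c_def)
      then have "(\<Sum>i\<in>insert j I. c i * A i u) = r u"
        using insert.hyps by (simp add: c_def r_def sum_negf)
      then show "q dvd (\<Sum>i\<in>insert j I. c i * A i u)" using * \<open>u \<in> U\<close> by auto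
    qed auto
    then show False using N by (simp add: c_def)
  qed
  then obtain u0 where u0: "u0 \<in> U" "\<not> q dvd r u0" by blast
  define M where "M = r u0"
  define g :: "'b \<Rightarrow> int" where "g = (\<lambda>v. if v = u0 then 1 else 0)"
  \<comment> \<open>The unit vector at \<open>u0\<close>, corrected to be orthogonal to the rows in
    \<open>I\<close>; its pairing with row \<open>j\<close> is the residual entry
    \<open>M\<close>.\<close>
  define f where "f = (\<lambda>u. N * g u - (\<Sum>b\<in>I. A b u0 * F b u))"
  have fI: "dot U (A a) f = 0" if "a \<in> I" for a
  proof -
    have "dot U (A a) f = N * A a u0 - (\<Sum>b\<in>I. A b u0 * (if a = b then N else 0))"
      unfolding f_def dot_linear using F that u0 assms(2)
      by (simp add: g_def dot_unit)
    then show ?thesis using that insert.hyps by (simp add: sum_mult_delta)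
  qed
  have fj: "dot U (A j) f = M"
    unfolding f_def dot_linear M_def r_def using u0 assms(2)
    by (simp add: g_def dot_unit mult.commute)
  \<comment> \<open>Scaling the new dual by \<open>N\<close> and the old ones by \<open>M\<close>
    gives all of them the factor \<open>M * N\<close> without any division.\<close>
  define F' where "F' = (\<lambda>b. if b = j then (\<lambda>u. N * f u) else (\<lambda>u. M * F b u - dot U (A j) (F b) * f u))"
  have "dual_family (insert j I) U A F' (M * N)"
    unfolding dual_family_def
  proof (intro ballI)
    fix a b assume ab: "a \<in> insert j I" "b \<in> insert j I"
    show "dot U (A a) (F' b) = (if a = b then M * N else 0)"
      using ab insert.hyps F[of a b] fI[of a] fj
      by (cases "b = j"; cases "a = j") (auto simp: F'_def dot_linear)
  qed
  moreover have "\<not> q dvd M * N" using u0 N assms(3) by (simp add: M_def prime_like_mult)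
  ultimately show ?case by blast
qed

text \<open>Pairing a relation with \<open>F b\<close> isolates \<open>c b * N\<close>. Duality is
  demanded only modulo \<open>q\<close>, so that the duals of one family can certify another family
  congruent to it.\<close>

lemma indep_of_dual:
  assumes "finite I" "prime_like q" "\<not> q dvd N"
    and F: "\<And>a b. a \<in> I \<Longrightarrow> b \<in> I \<Longrightarrow> q dvd dot U (A a) (F b) - (if a = b then N else 0)"
  shows "indep q I U A"
  unfolding indep_def
proof (intro allI impI ballI)
  fix c b assume c: "\<forall>u\<in>U. q dvd (\<Sum>i\<in>I. c i * A i u)" and b: "b \<in> I"
  have "q dvd dot U (\<lambda>u. \<Sum>i\<in>I. c i * A i u) (F b)" using c by (intro dvd_dot) auto
  then have 1: "q dvd (\<Sum>i\<in>I. c i * dot U (A i) (F b))" by (simp add: dot_linear)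
  have "q dvd (\<Sum>i\<in>I. c i * (dot U (A i) (F b) - (if i = b then N else 0)))"
    using F b by (intro dvd_sum dvd_mult) auto
  then have "q dvd (\<Sum>i\<in>I. c i * dot U (A i) (F b)) - c b * N"
    using assms(1) b by (simp add: right_diff_distrib sum_subtractf sum_mult_delta)
  then have "q dvd c b * N" using 1 by (metis dvd_diff_commute dvd_diff_left_iff)
  then show "q dvd c b" using assms(2,3) by (auto simp: prime_like_mult)
qed

text \<open>A relation among the \<open>A'\<close> is one among the \<open>A\<close> with
  coefficients \<open>c i * K i\<close>. The factors \<open>K i\<close> allow for the rescaling that
  exact lifting causes.\<close>

lemma indep_cong_mod:
  assumes "finite I" "finite U" "prime_like q" "indep q I U A"
    and "\<And>i u. i \<in> I \<Longrightarrow> u \<in> U \<Longrightarrow> q dvd A' i u - K i * A i u"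
    and "\<And>i. i \<in> I \<Longrightarrow> \<not> q dvd K i"
  shows "indep q I U A'"
  unfolding indep_def
proof (intro allI impI)
  fix c assume c: "\<forall>u\<in>U. q dvd (\<Sum>i\<in>I. c i * A' i u)"
  have "q dvd c i * K i" if "i \<in> I" for i
  proof (rule indepD[OF assms(4) _ that])
    fix u assume u: "u \<in> U"
    have "q dvd (\<Sum>i\<in>I. c i * (A' i u - K i * A i u))"
      using assms(5) u by (intro dvd_sum dvd_mult) auto
    then have "q dvd (\<Sum>i\<in>I. c i * A' i u) - (\<Sum>i\<in>I. c i * K i * A i u)"
      by (simp add: right_diff_distrib sum_subtractf mult.assoc)
    then show "q dvd (\<Sum>i\<in>I. c i * K i * A i u)"
      using c u by (metis dvd_diff_commute dvd_diff_left_iff)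
  qed
  then show "\<forall>i\<in>I. q dvd c i" using assms(3,6) by (auto simp: prime_like_mult)
qed

text \<open>The dual family found modulo \<open>q\<close> is exact over the integers and its factor
  is nonzero, so it also certifies independence over the rationals.\<close>

lemma indep_imp_indep_0:
  assumes "finite I" "finite U" "prime_like q" "indep q I U A"
  shows "indep 0 I U A"
proof -
  obtain F N where "\<not> q dvd N" "dual_family I U A F N" using dual_of_indep[OF assms] by blast
  then show ?thesis
    by (intro indep_of_dual[where N = N and F = F] assms prime_like_0) (auto simp: dual_family_def)
qed

text \<open>Gaussian elimination for fewer equations than unknowns, with cross-multiplication in
  place of division.\<close>

lemma kernel_exists:
  fixes A :: "'e \<Rightarrow> 'u \<Rightarrow> int"
  assumes "finite E" "finite U" "card E < card U" "prime_like q"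
  shows "\<exists>x. (\<exists>u\<in>U. \<not> q dvd x u) \<and> (\<forall>e\<in>E. q dvd dot U (A e) x)"
  using assms(1-3)
proof (induction E arbitrary: U A rule: finite_induct)
  case empty
  then obtain u where "u \<in> U" by fastforce
  then show ?case using assms(4) by (auto simp: prime_like_def intro!: exI[of _ "\<lambda>_. 1"])
next
  case (insert a E)
  show ?case
  proof (cases "\<forall>u\<in>U. q dvd A a u")
    case True
    obtain x where x: "\<exists>u\<in>U. \<not> q dvd x u" "\<forall>e\<in>E. q dvd dot U (A e) x"
      using insert.IH[of U A] insert.prems insert.hyps by auto
    have "q dvd dot U (A a) x" using True by (intro dvd_dot) auto
    then show ?thesis using x by blast
  next
    case False
    then obtain p where p: "p \<in> U" "\<not> q dvd A a p" by blast
    define V where "V = U - {p}"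
    have U: "U = insert p V" "p \<notin> V" "finite V" using p insert.prems by (auto simp: V_def)
    have "card E < card V" using insert.prems insert.hyps U by simp
    then obtain x where x: "\<exists>u\<in>V. \<not> q dvd x u"
      "\<forall>e\<in>E. q dvd dot V (\<lambda>u. A a p * A e u - A e p * A a u) x"
      using insert.IH[of V "\<lambda>e u. A a p * A e u - A e p * A a u"] U by blast
    \<comment> \<open>Back substitution: the pivot coordinate is chosen to satisfy equation
      \<open>a\<close>, and the others are scaled by the pivot entry \<open>A a p\<close>.\<close>
    define y where "y = (\<lambda>u. if u = p then - dot V (A a) x else A a p * x u)"
    have y: "dot U (A e) y = dot V (\<lambda>u. A a p * A e u - A e p * A a u) x" for e
    proof -
      have "(\<Sum>u\<in>V. A e u * y u) = (\<Sum>u\<in>V. A e u * (A a p * x u))"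
        using U by (intro sum.cong) (auto simp: y_def)
      then have "dot U (A e) y = - A e p * dot V (A a) x + dot V (A e) (\<lambda>u. A a p * x u)"
        using U by (simp add: dot_def y_def)
      then show ?thesis by (simp add: dot_linear)
    qed
    have "dot U (A a) y = 0" unfolding y by (simp add: dot_def)
    moreover have "\<exists>u\<in>U. \<not> q dvd y u"
      using x(1) U p assms(4) by (auto simp: y_def prime_like_mult)
    ultimately show ?thesis using x(2) y by (intro exI[of _ y]) auto
  qed
qed

lemma dependent_insert:
  assumes "finite I" "indep q I U A" "\<not> indep q (insert j I) U A"
  shows "\<exists>c. \<not> q dvd c j \<and> (\<forall>u\<in>U. q dvd (\<Sum>i\<in>insert j I. c i * A i u))"
proof -
  obtain c i where c: "\<forall>u\<in>U. q dvd (\<Sum>i\<in>insert j I. c i * A i u)"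
    and i: "i \<in> insert j I" "\<not> q dvd c i"
    using assms(3) unfolding indep_def by blast
  have j: "j \<notin> I" using assms by (metis insert_absorb)
  have "\<not> q dvd c j"
  proof
    assume cj: "q dvd c j"
    have "q dvd c i" if "i \<in> I" for i
    proof (rule indepD[OF assms(2) _ that])
      fix u assume "u \<in> U"
      then have "q dvd c j * A j u + (\<Sum>i\<in>I. c i * A i u)" using c j assms(1) by auto
      then show "q dvd (\<Sum>i\<in>I. c i * A i u)" using cj by (simp add: dvd_add_right_iff)
    qed
    then show False using i cj by auto
  qed
  then show ?thesis using c by blast
qed

section \<open>Maximal independent sets of rows\<close>

lemma maximal_indep:
  assumes "finite M"
  shows "\<exists>I\<subseteq>M. indep q I U A \<and> (\<forall>J\<subseteq>M. indep q J U A \<longrightarrow> card J \<le> card I)"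
proof -
  let ?S = "{I. I \<subseteq> M \<and> indep q I U A}"
  have "finite ?S" using assms by simp
  moreover have "{} \<in> ?S" by (simp add: indep_def)
  ultimately have "Max (card ` ?S) \<in> card ` ?S" and "\<forall>J\<in>?S. card J \<le> Max (card ` ?S)"
    by (auto intro!: Max_in)
  then show ?thesis by auto
qed

lemma maximal_indep_dependent:
  assumes "finite M" "I \<subseteq> M" "indep q I U A" "\<forall>J\<subseteq>M. indep q J U A \<longrightarrow> card J \<le> card I"
    and "j \<in> M - I"
  shows "\<exists>c. \<not> q dvd c j \<and> (\<forall>u\<in>U. q dvd (\<Sum>i\<in>insert j I. c i * A i u))"
proof (rule dependent_insert)
  show fin: "finite I" using assms finite_subset by blast
  show "\<not> indep q (insert j I) U A"
  proof
    assume "indep q (insert j I) U A"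
    then have "card (insert j I) \<le> card I" using assms by auto
    then show False using assms(5) fin by simp
  qed
qed (use assms in auto)

section \<open>The integer symplectic form\<close>

text \<open>\<open>False\<close> marks the X exponent and \<open>True\<close> the Z exponent of a
  register, so a Pauli becomes one vector and restricting it to the registers \<open>T\<close> is
  restricting it to \<open>coords T\<close>.\<close>

definition coords :: "nat set \<Rightarrow> (nat \<times> bool) set" where
  "coords T = T \<times> UNIV"

text \<open>The symplectic matrix as an operator. It expresses symplectic products as dot products,
  and since its square is -1 it turns dual vectors into symplectic duals up to sign.\<close>

definition tw :: "(nat \<times> bool \<Rightarrow> int) \<Rightarrow> nat \<times> bool \<Rightarrow> int" where
  "tw y = (\<lambda>(t, b). if b then - y (t, False) else y (t, True))"

definition om :: "nat \<Rightarrow> (nat \<times> bool \<Rightarrow> int) \<Rightarrow> (nat \<times> bool \<Rightarrow> int) \<Rightarrow> int" where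
  "om n x y = dot (coords {..<n}) x (tw y)"

lemma finite_coords [simp]: "finite T \<Longrightarrow> finite (coords T)"
  by (simp add: coords_def)

lemma card_coords: "card (coords T) = 2 * card T"
  by (simp add: coords_def card_cartesian_product)

lemma coords_mono: "S \<subseteq> T \<Longrightarrow> coords S \<subseteq> coords T"
  by (auto simp: coords_def)

lemma sum_coords:
  "finite T \<Longrightarrow> (\<Sum>u\<in>coords T. f u) = (\<Sum>t\<in>T. f (t, False) + f (t, True) :: 'a::comm_monoid_add)"
  unfolding coords_def
  using sum.cartesian_product[of "\<lambda>t b. f (t, b)" UNIV T] by (simp add: UNIV_bool)

lemma om_eq: "om n x y = (\<Sum>t<n. x (t, False) * y (t, True) - y (t, False) * x (t, True))"
  by (simp add: om_def dot_def sum_coords tw_def mult.commute)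

lemma om_antisym: "om n x y = - om n y x"
  by (simp add: om_eq sum_negf[symmetric] algebra_simps)

lemma om_self: "om n x x = 0"
  by (simp add: om_eq)

lemma tw_tw: "tw (tw y) = (\<lambda>u. - y u)"
  by (auto simp: tw_def fun_eq_iff)

lemma tw_linear:
  "tw (\<lambda>u. c * y u) = (\<lambda>u. c * tw y u)"
  "tw (\<lambda>u. y u + z u) = (\<lambda>u. tw y u + tw z u)"
  "tw (\<lambda>u. y u - z u) = (\<lambda>u. tw y u - tw z u)"
  "tw (\<lambda>u. \<Sum>i\<in>I. d i * Y i u) = (\<lambda>u. \<Sum>i\<in>I. d i * tw (Y i) u)"
  by (auto simp: tw_def fun_eq_iff sum_negf)

lemmas om_linear = om_def tw_linear dot_linear

lemma om_linear_left:
  "om n (\<lambda>u. c * y u) x = c * om n y x"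
  "om n (\<lambda>u. y u + z u) x = om n y x + om n z x"
  "om n (\<lambda>u. y u - z u) x = om n y x - om n z x"
  "om n (\<lambda>u. \<Sum>i\<in>I. d i * Y i u) x = (\<Sum>i\<in>I. d i * om n (Y i) x)"
  by (simp_all add: om_linear)

lemma om_linear_right:
  "om n x (\<lambda>u. c * y u) = c * om n x y"
  "om n x (\<lambda>u. y u + z u) = om n x y + om n x z"
  "om n x (\<lambda>u. y u - z u) = om n x y - om n x z"
  "om n x (\<lambda>u. \<Sum>i\<in>I. d i * Y i u) = (\<Sum>i\<in>I. d i * om n x (Y i))"
  by (simp_all add: om_linear)

lemma om_cong_mod_left:
  "(\<And>u. u \<in> coords {..<n} \<Longrightarrow> q dvd x u - x' u) \<Longrightarrow> q dvd om n x y - om n x' y"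
  unfolding om_def by (rule dot_cong_mod)

lemma om_supported:
  assumes "T \<subseteq> {..<n}" "\<And>u. u \<in> coords {..<n} - coords T \<Longrightarrow> v u = 0"
  shows "om n v y = dot (coords T) v (tw y)"
  unfolding om_def dot_def
  by (rule sum.mono_neutral_right) (use assms in \<open>auto intro: coords_mono[THEN subsetD]\<close>)

text \<open>With the twisted duals added, there are \<open>2 * r\<close> vectors in dimension
  \<open>2 * n\<close>, hence a relation if \<open>r > n\<close>. Pairing it with \<open>h a\<close>
  kills the \<open>h\<close> part by isotropy and isolates the coefficient of one dual; independence
  of \<open>h\<close> then kills the rest.\<close>

lemma isotropic_indep_card:
  assumes "prime_like q" "indep q {..<r} (coords {..<n}) h"
    and iso: "\<And>i j. i < r \<Longrightarrow> j < r \<Longrightarrow> q dvd om n (h i) (h j)"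
  shows "r \<le> n"
proof (rule ccontr)
  assume "\<not> r \<le> n"
  define D where "D = coords {..<n}"
  have D: "finite D" "card D = 2 * n" by (auto simp: D_def card_coords)
  obtain F N where N: "\<not> q dvd N" and "dual_family {..<r} D h F N"
    using dual_of_indep[OF _ _ assms(1,2)] by (auto simp: D_def)
  then have F: "dot D (h a) (F b) = (if a = b then N else 0)" if "a < r" "b < r" for a b
    using that by (auto simp: dual_family_def)
  \<comment> \<open>Coordinates act as equations and the \<open>2 * r\<close> vectors as unknowns,
    so a kernel vector is a linear relation.\<close>
  define A where "A = (\<lambda>u s. case s of Inl i \<Rightarrow> h i u | Inr i \<Rightarrow> - tw (F i) u)"
  define S :: "(nat + nat) set" where "S = {..<r} <+> {..<r}"
  have sumS: "(\<Sum>s\<in>S. f s) = (\<Sum>i<r. f (Inl i)) + (\<Sum>i<r. f (Inr i))" for f :: "nat + nat \<Rightarrow> int"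
    by (simp add: S_def sum.Plus comp_def)
  have "\<exists>x. (\<exists>s\<in>S. \<not> q dvd x s) \<and> (\<forall>u\<in>D. q dvd dot S (A u) x)"
    using D \<open>\<not> r \<le> n\<close> by (intro kernel_exists assms(1)) (auto simp: S_def card_Plus)
  then obtain x s where s: "s \<in> S" "\<not> q dvd x s" and x: "\<And>u. u \<in> D \<Longrightarrow> q dvd dot S (A u) x"
    by blast
  have xe: "dot S (A u) x = (\<Sum>i<r. x (Inl i) * h i u) - (\<Sum>i<r. x (Inr i) * tw (F i) u)" for u
    by (simp add: dot_def sumS A_def sum_negf mult.commute)
  have yz: "q dvd x (Inr a)" if a: "a < r" for a
  proof -
    have "q dvd om n (\<lambda>u. dot S (A u) x) (h a)"
      unfolding om_def by (rule dvd_dot) (simp add: x[unfolded D_def])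
    moreover have "om n (\<lambda>u. dot S (A u) x) (h a)
       = (\<Sum>i<r. x (Inl i) * om n (h i) (h a)) + (\<Sum>i<r. x (Inr i) * om n (h a) (tw (F i)))"
      unfolding xe om_linear_left by (simp add: om_antisym[of n _ "h a"] sum_negf)
    moreover have "om n (h a) (tw (F i)) = - (if i = a then N else 0)" if "i < r" for i
      using F[OF a that] dot_scale_right[of D "h a" "-1" "F i"] by (auto simp: om_def tw_tw D_def)
    moreover have "q dvd (\<Sum>i<r. x (Inl i) * om n (h i) (h a))"
      using iso a by (intro dvd_sum dvd_mult) auto
    ultimately have "q dvd (\<Sum>i<r. x (Inr i) * - (if i = a then N else 0))"
      by (simp add: dvd_add_right_iff)
    then have "q dvd x (Inr a) * N" using a
      by (simp add: sum_negf sum_mult_delta)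
    then show ?thesis using N assms(1) by (simp add: prime_like_mult)
  qed
  have "q dvd x (Inl a)" if "a < r" for a
  proof (rule indepD[OF assms(2)])
    fix u assume "u \<in> coords {..<n}"
    then have "q dvd (\<Sum>i<r. x (Inl i) * h i u) - (\<Sum>i<r. x (Inr i) * tw (F i) u)"
      using x[of u] by (simp add: xe D_def)
    moreover have "q dvd (\<Sum>i<r. x (Inr i) * tw (F i) u)" using yz by (intro dvd_sum) auto
    ultimately show "q dvd (\<Sum>i<r. x (Inl i) * h i u)" by (metis diff_add_cancel dvd_add)
  qed (use that in auto)
  then show False using s yz by (auto simp: S_def)
qed


section \<open>The quantum Singleton bound\<close>

text \<open>The rows outside a maximal independent set on the complement of A are, modulo rows
  vanishing off A, combinations of the others, so they impose no further condition on vectors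
  supported on B.\<close>

lemma singleton_half:
  fixes g :: "'i \<Rightarrow> nat \<times> bool \<Rightarrow> int"
  assumes q: "prime_like q" and M: "finite M" and ind: "indep q M (coords {..<n}) g"
    and AB: "A \<inter> B = {}" "B \<subseteq> {..<n}"
    and IA: "IA \<subseteq> M" "indep q IA (coords ({..<n} - A)) g"
      "\<forall>J\<subseteq>M. indep q J (coords ({..<n} - A)) g \<longrightarrow> card J \<le> card IA"
    and IB: "IB \<subseteq> M" "indep q IB (coords ({..<n} - B)) g"
    and H: "\<And>v. (\<And>u. u \<in> coords {..<n} - coords B \<Longrightarrow> v u = 0) \<Longrightarrow>
        (\<And>i. i \<in> M \<Longrightarrow> q dvd om n v (g i)) \<Longrightarrow>
        \<exists>c. \<forall>u\<in>coords {..<n}. q dvd v u - (\<Sum>i\<in>M. c i * g i u)"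
  shows "2 * card B + card IB \<le> card IA + card M"
proof (rule ccontr)
  assume contra: "\<not> ?thesis"
  define D where "D = coords {..<n}"
  define U where "U = coords B"
  have finD: "finite D" and finB: "finite B" and finU: "finite U"
    using AB by (auto simp: D_def U_def finite_subset)
  have UD: "U \<subseteq> D" using AB coords_mono unfolding U_def D_def by blast
  have finI: "finite IA" "finite IB" using IA(1) IB(1) M by (auto intro: finite_subset)
  obtain F N where N: "\<not> q dvd N" and "dual_family M D g F N"
    using dual_of_indep[OF M _ q ind] by (auto simp: D_def)
  then have F: "dot D (g a) (F b) = (if a = b then N else 0)" if "a \<in> M" "b \<in> M" for a b
    using that by (auto simp: dual_family_def)
  \<comment> \<open>Two kinds of condition on a vector supported on \<open>B\<close>: orthogonality
    to the rows in \<open>IA\<close>, and vanishing coefficients, read off by the duals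
    \<open>F\<close>, at the rows outside \<open>IB\<close>. By the negated inequality they are
    fewer than the coordinates of \<open>B\<close>.\<close>
  define E :: "('i + 'i) set" where "E = IA <+> (M - IB)"
  define Q where "Q = (\<lambda>s. case s of Inl i \<Rightarrow> tw (g i) | Inr i \<Rightarrow> F i)"
  have "card E = card IA + (card M - card IB)"
    using finI M IB by (simp add: E_def card_Plus card_Diff_subset)
  moreover have "card IB \<le> card M" using IB M by (simp add: card_mono)
  ultimately have "card E < card U" using contra by (simp add: U_def card_coords)
  then obtain x where x: "\<exists>u\<in>U. \<not> q dvd x u" "\<And>s. s \<in> E \<Longrightarrow> q dvd dot U (Q s) x"
    using kernel_exists[of E U q Q] finI M finU q by (auto simp: E_def)
  define v where "v = (\<lambda>u. if u \<in> U then x u else 0)"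
  have v0: "v u = 0" if "u \<in> coords {..<n} - coords B" for u
    using that by (simp add: v_def U_def)
  have dotv: "dot D v y = dot U y x" for y
  proof -
    have "dot D v y = (\<Sum>u\<in>U. v u * y u)" unfolding dot_def
      by (rule sum.mono_neutral_right) (use finD UD in \<open>auto simp: v_def\<close>)
    then show ?thesis by (simp add: dot_def v_def mult.commute)
  qed
  have omIA: "q dvd om n v (g i)" if "i \<in> IA" for i
    using x(2)[of "Inl i"] that by (simp add: om_def D_def[symmetric] dotv E_def Q_def InlI)
  have om: "q dvd om n v (g j)" if j: "j \<in> M" for j
  proof (cases "j \<in> IA")
    case False
    then obtain c where c: "\<not> q dvd c j"
      "\<forall>u\<in>coords ({..<n} - A). q dvd (\<Sum>i\<in>insert j IA. c i * g i u)"
      using maximal_indep_dependent[OF M IA] j by blast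
    have "q dvd dot U (tw (\<lambda>u. \<Sum>i\<in>insert j IA. c i * g i u)) x"
    proof (rule dvd_dot)
      fix u assume "u \<in> U"
      then have "(t, b) \<in> coords ({..<n} - A)" if "t = fst u" for t b
        using AB that by (auto simp: U_def coords_def)
      then show "q dvd tw (\<lambda>u. \<Sum>i\<in>insert j IA. c i * g i u) u"
        using c(2) by (cases u) (auto simp: tw_def)
    qed
    then have "q dvd (\<Sum>i\<in>insert j IA. c i * om n v (g i))"
      by (simp only: om_def D_def[symmetric] dotv[symmetric] tw_linear dot_linear)
    then have "q dvd c j * om n v (g j) + (\<Sum>i\<in>IA. c i * om n v (g i))"
      using False finI by simp
    moreover have "q dvd (\<Sum>i\<in>IA. c i * om n v (g i))" using omIA by (intro dvd_sum) auto
    ultimately have "q dvd c j * om n v (g j)" by (simp add: dvd_add_left_iff)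
    then show ?thesis using c q by (simp add: prime_like_mult)
  qed (use omIA in auto)
  obtain c where c: "\<And>u. u \<in> D \<Longrightarrow> q dvd v u - (\<Sum>i\<in>M. c i * g i u)"
    using H[OF v0 om] by (auto simp: D_def)
  have cIB: "q dvd c j" if "j \<in> M - IB" for j
  proof -
    have "q dvd dot D v (F j) - dot D (\<lambda>u. \<Sum>i\<in>M. c i * g i u) (F j)"
      using c by (rule dot_cong_mod)
    moreover have "dot D (\<lambda>u. \<Sum>i\<in>M. c i * g i u) (F j) = c j * N"
      using F that M by (simp add: dot_linear sum_mult_delta)
    moreover have "q dvd dot D v (F j)"
      using x(2)[of "Inr j"] that by (simp add: dotv E_def Q_def InrI)
    ultimately have "q dvd c j * N" by (metis dvd_diff_right_iff)
    then show ?thesis using N q by (simp add: prime_like_mult)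
  qed
  \<comment> \<open>\<open>v\<close> vanishes off \<open>B\<close>, where the rows in
    \<open>IB\<close> are independent; so all coefficients vanish modulo \<open>q\<close>, and with
    them \<open>v\<close>.\<close>
  have "q dvd c i" if "i \<in> IB" for i
  proof (rule indepD[OF IB(2) _ that])
    fix u assume u: "u \<in> coords ({..<n} - B)"
    then have "v u = 0" and "u \<in> D" by (auto simp: v_def U_def D_def coords_def)
    then have "q dvd (\<Sum>i\<in>M. c i * g i u)" using c[of u] by simp
    moreover have "(\<Sum>i\<in>M. c i * g i u) = (\<Sum>i\<in>IB. c i * g i u) + (\<Sum>i\<in>M - IB. c i * g i u)"
      using sum.subset_diff[OF IB(1) M] by (simp add: add.commute)
    moreover have "q dvd (\<Sum>i\<in>M - IB. c i * g i u)" using cIB by (intro dvd_sum) auto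
    ultimately show "q dvd (\<Sum>i\<in>IB. c i * g i u)" by (simp add: dvd_add_left_iff)
  qed
  then have call: "q dvd c i" if "i \<in> M" for i using cIB that by blast
  obtain u where u: "u \<in> U" "\<not> q dvd x u" using x by blast
  have "q dvd (\<Sum>i\<in>M. c i * g i u)" using call by (intro dvd_sum) auto
  moreover have "q dvd v u - (\<Sum>i\<in>M. c i * g i u)" using c u UD by blast
  ultimately have "q dvd v u" by (metis dvd_diff_left_iff)
  then show False using u by (simp add: v_def)
qed

text \<open>Adding \<open>singleton_half\<close> for \<open>A\<close>, \<open>B\<close> and for the
  swapped pair cancels the ranks and leaves \<open>card A + card B\<close> at most
  \<open>card M\<close>. Hypothesis \<open>H\<close> says that undetectable errors on at most
  \<open>t\<close> registers lie in the span of the generators modulo \<open>q\<close>.\<close>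

lemma singleton_bound:
  fixes g :: "'i \<Rightarrow> nat \<times> bool \<Rightarrow> int"
  assumes q: "prime_like q" and M: "finite M" and ind: "indep q M (coords {..<n}) g"
    and H: "\<And>T v. T \<subseteq> {..<n} \<Longrightarrow> card T \<le> t \<Longrightarrow>
        (\<And>u. u \<in> coords {..<n} - coords T \<Longrightarrow> v u = 0) \<Longrightarrow>
        (\<And>i. i \<in> M \<Longrightarrow> q dvd om n v (g i)) \<Longrightarrow>
        \<exists>c. \<forall>u\<in>coords {..<n}. q dvd v u - (\<Sum>i\<in>M. c i * g i u)"
    and "card M < n"
  shows "2 * t \<le> card M"
proof (rule ccontr)
  assume contra: "\<not> ?thesis"
  \<comment> \<open>If \<open>2 * t > card M\<close>, the first \<open>card M + 1\<close> registers
    split into two blocks of at most \<open>t\<close>; the second is empty when \<open>t\<close>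
    exceeds \<open>card M\<close>.\<close>
  define a where "a = min t (card M + 1)"
  define A where "A = {..<a}"
  define B where "B = {a..<card M + 1}"
  have A: "A \<subseteq> {..<n}" "card A \<le> t" and B: "B \<subseteq> {..<n}" "card B \<le> t" and AB: "A \<inter> B = {}"
    and card: "card A + card B = card M + 1"
    using contra \<open>card M < n\<close> by (auto simp: A_def B_def a_def)
  obtain IA where IA: "IA \<subseteq> M" "indep q IA (coords ({..<n} - A)) g"
      "\<forall>J\<subseteq>M. indep q J (coords ({..<n} - A)) g \<longrightarrow> card J \<le> card IA"
    using maximal_indep[OF M] by meson
  obtain IB where IB: "IB \<subseteq> M" "indep q IB (coords ({..<n} - B)) g"
      "\<forall>J\<subseteq>M. indep q J (coords ({..<n} - B)) g \<longrightarrow> card J \<le> card IB"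
    using maximal_indep[OF M] by meson
  have "2 * card B + card IB \<le> card IA + card M"
    by (rule singleton_half[OF q M ind AB B(1) IA IB(1,2) H[OF B]])
  moreover have "2 * card A + card IA \<le> card IB + card M"
    using AB by (intro singleton_half[OF q M ind _ A(1) IB IA(1,2) H[OF A]]) auto
  ultimately show False using card by linarith
qed

section \<open>Exact isotropic lifts\<close>

text \<open>Integer Gram-Schmidt: each new vector is scaled by \<open>N\<close> and corrected along
  the twisted duals of the earlier lifts until exactly orthogonal to them. The correction
  coefficients are divisible by \<open>q\<close>, so modulo \<open>q\<close> only a factor
  \<open>K i\<close> remains. The first vector stays unchanged, which is how the logical error
  survives.\<close>

lemma isotropic_lift:
  fixes r :: nat
  assumes q: "prime_like q" and "indep q {..r} (coords {..<n}) h"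
    and "\<And>i j. i \<le> r \<Longrightarrow> j \<le> r \<Longrightarrow> q dvd om n (h i) (h j)"
  shows "\<exists>L K. L 0 = h 0 \<and>
      (\<forall>i\<le>r. \<not> q dvd K i \<and> (\<forall>u\<in>coords {..<n}. q dvd L i u - K i * h i u)) \<and>
      (\<forall>i\<le>r. \<forall>j\<le>r. om n (L i) (L j) = 0)"
  using assms(2,3)
proof (induction r)
  case 0
  show ?case
    by (intro exI[of _ h] exI[of _ "\<lambda>_. 1"]) (use q in \<open>auto simp: om_self prime_like_def\<close>)
next
  case (Suc r)
  define D where "D = coords {..<n}"
  have indr: "indep q {..r} D h"
    using indep_subset[OF Suc.prems(1), of "{..r}"] by (simp add: D_def)
  have "\<exists>L K. L 0 = h 0 \<and>
      (\<forall>i\<le>r. \<not> q dvd K i \<and> (\<forall>u\<in>D. q dvd L i u - K i * h i u)) \<and>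
      (\<forall>i\<le>r. \<forall>j\<le>r. om n (L i) (L j) = 0)"
    using Suc.IH[OF indr[unfolded D_def] Suc.prems(2)] by (simp add: D_def)
  then obtain L K where L0: "L 0 = h 0" and K: "\<And>i. i \<le> r \<Longrightarrow> \<not> q dvd K i"
    and L: "\<And>i u. i \<le> r \<Longrightarrow> u \<in> D \<Longrightarrow> q dvd L i u - K i * h i u"
    and iso: "\<And>i j. i \<le> r \<Longrightarrow> j \<le> r \<Longrightarrow> om n (L i) (L j) = 0"
    by blast
  have "indep q {..r} D L"
    by (rule indep_cong_mod[OF _ _ q indr]) (use L K in \<open>auto simp: D_def\<close>)
  then obtain F N where N: "\<not> q dvd N" and "dual_family {..r} D L F N"
    using dual_of_indep[of "{..r}" D q L] q by (auto simp: D_def)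
  then have F: "dot D (L a) (F b) = (if a = b then N else 0)" if "a \<le> r" "b \<le> r" for a b
    using that by (auto simp: dual_family_def)
  have Fo: "om n (L a) (tw (F b)) = - (if a = b then N else 0)" if "a \<le> r" "b \<le> r" for a b
    using F[OF that] dot_scale_right[of D "L a" "-1" "F b"] by (auto simp: om_def tw_tw D_def)
  define x where "x = (\<lambda>u. N * h (Suc r) u + (\<Sum>b\<in>{..r}. om n (L b) (h (Suc r)) * tw (F b) u))"
  have ox: "om n (L a) x = 0" if "a \<le> r" for a
  proof -
    have "om n (L a) x = N * om n (L a) (h (Suc r))
        + (\<Sum>b\<in>{..r}. om n (L b) (h (Suc r)) * - (if a = b then N else 0))"
      unfolding x_def om_linear_right using Fo that by simp
    then show ?thesis using that by (simp add: sum_negf sum_mult_delta)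
  qed
  have ox': "om n x (L a) = 0" if "a \<le> r" for a
    using ox[OF that] om_antisym[of n x] by simp
  have dv: "q dvd om n (L b) (h (Suc r))" if "b \<le> r" for b
  proof -
    have "q dvd om n (L b) (h (Suc r)) - om n (\<lambda>u. K b * h b u) (h (Suc r))"
      using L that by (intro om_cong_mod_left) (auto simp: D_def)
    moreover have "q dvd om n (\<lambda>u. K b * h b u) (h (Suc r))"
      unfolding om_linear_left using Suc.prems(2)[of b "Suc r"] that by simp
    ultimately show ?thesis by (metis diff_add_cancel dvd_add)
  qed
  have xh: "q dvd x u - N * h (Suc r) u" for u
    unfolding x_def using dv by (auto intro!: dvd_sum)
  let ?L = "\<lambda>i. if i = Suc r then x else L i" and ?K = "\<lambda>i. if i = Suc r then N else K i"
  show ?case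
    by (intro exI[of _ ?L] exI[of _ ?K])
      (use L0 K L iso ox ox' N xh in \<open>auto simp: le_Suc_eq om_self D_def\<close>)
qed

section \<open>Raising the ranks of restrictions by transvections\<close>

text \<open>A prime above the absolute value of the duality factor does not divide it, so the old
  duals certify independence modulo \<open>p\<close> of every family congruent to \<open>A\<close>,
  and this implies rational independence.\<close>

lemma indep_0_stable:
  assumes "finite I" "finite U" "indep 0 I U A"
  shows "\<exists>N::nat. \<forall>p::int. prime p \<and> p > int N \<longrightarrow>
    (\<forall>A'. (\<forall>i\<in>I. \<forall>u\<in>U. p dvd A' i u - A i u) \<longrightarrow> indep 0 I U A')"
proof -
  obtain F N where N: "N \<noteq> 0" and "dual_family I U A F N"
    using dual_of_indep[OF assms(1,2) prime_like_0 assms(3)] by auto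
  then have F: "dot U (A a) (F b) = (if a = b then N else 0)" if "a \<in> I" "b \<in> I" for a b
    using that by (auto simp: dual_family_def)
  show ?thesis
  proof (intro exI[of _ "nat \<bar>N\<bar>"] allI impI, elim conjE)
    fix p :: int and A'
    assume p: "prime p" "int (nat \<bar>N\<bar>) < p" and A': "\<forall>i\<in>I. \<forall>u\<in>U. p dvd A' i u - A i u"
    have "\<not> p dvd N"
      using p(2) zdvd_imp_le[of p "\<bar>N\<bar>"] N by auto
    moreover have "p dvd dot U (A' a) (F b) - (if a = b then N else 0)" if "a \<in> I" "b \<in> I" for a b
      using dot_cong_mod[of U p "A' a" "A a" "F b"] A' that F by auto
    ultimately have "indep p I U A'"
      using indep_of_dual[of I p N U A' F] assms(1) prime_like_prime[OF p(1)] by blast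
    then show "indep 0 I U A'" using indep_imp_indep_0 assms prime_like_prime[OF p(1)] by blast
  qed
qed

definition transv :: "nat \<Rightarrow> int \<Rightarrow> (nat \<times> bool \<Rightarrow> int) \<Rightarrow> (nat \<times> bool \<Rightarrow> int) \<Rightarrow> nat \<times> bool \<Rightarrow> int"
  where "transv n C w x = (\<lambda>u. x u + C * om n x w * w u)"

lemma om_transv: "om n (transv n C w x) (transv n C w y) = om n x y"
  unfolding transv_def om_linear_left om_linear_right
  by (simp add: om_self om_antisym[of n w] algebra_simps)

text \<open>In the two-row family \<open>e\<close>, \<open>l\<close>, the twisted dual belonging to
  \<open>l\<close> has the required pairings.\<close>

lemma separating_vector:
  assumes "\<And>a b. (\<And>u. u \<in> coords {..<n} \<Longrightarrow> a * e u + b * l u = 0) \<Longrightarrow> a = 0 \<and> b = 0"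
  shows "\<exists>w. om n e w = 0 \<and> om n l w \<noteq> 0"
proof -
  define D where "D = coords {..<n}"
  define A where "A = (\<lambda>i::bool. if i then l else e)"
  have "indep 0 UNIV D A"
    unfolding indep_def
  proof (intro allI impI ballI)
    fix c i assume c: "\<forall>u\<in>D. 0 dvd (\<Sum>i\<in>UNIV. c i * A i u)"
    have "c False = 0 \<and> c True = 0"
      by (rule assms) (use c in \<open>auto simp: D_def UNIV_bool A_def add.commute\<close>)
    then show "0 dvd c i" by (cases i) auto
  qed
  then obtain F N where N: "N \<noteq> 0" and F: "dual_family UNIV D A F N"
    using dual_of_indep[of "UNIV :: bool set" D 0 A] prime_like_0 by (auto simp: D_def)
  have *: "om n y (tw (F True)) = - dot D y (F True)" for y
    using dot_scale_right[of D y "-1" "F True"] by (simp add: om_def tw_tw D_def)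
  have "dot D e (F True) = 0" "dot D l (F True) = N"
    using F unfolding dual_family_def by (auto simp: A_def UNIV_bool)
  then show ?thesis using N by (intro exI[of _ "tw (F True)"]) (simp add: *)
qed

text \<open>Let \<open>y\<close> be a combination of the rows in \<open>insert j I\<close> whose
  transvected image vanishes on \<open>T\<close>. Pairing with \<open>v\<close> gives
  \<open>om n y w = 0\<close>; then \<open>y\<close> itself vanishes on \<open>T\<close>, is
  proportional to \<open>l\<close>, and is trivial because \<open>om n l w\<close> is
  nonzero.\<close>

lemma rank_increase:
  assumes ind: "indep 0 {..m} (coords {..<n}) H" and T: "T \<subseteq> {..<n}"
    and I: "I \<subseteq> {1..m}" "indep 0 I (coords T) H"
      "\<forall>J\<subseteq>{1..m}. indep 0 J (coords T) H \<longrightarrow> card J \<le> card I"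
    and less: "card I < 2 * card T" "card I < m"
    and e: "\<exists>u\<in>coords {..<n} - coords T. H 0 u \<noteq> 0"
  shows "\<exists>w. om n (H 0) w = 0 \<and> (\<forall>C. C \<noteq> 0 \<longrightarrow>
    (\<exists>J\<subseteq>{1..m}. card J = Suc (card I) \<and> indep 0 J (coords T) (\<lambda>i. transv n C w (H i))))"
proof -
  define D where "D = coords {..<n}"
  define U where "U = coords T"
  have fin: "finite D" "finite T" "finite U" "finite I"
    using T I by (auto simp: D_def U_def finite_subset)
  have UD: "U \<subseteq> D" using T coords_mono unfolding U_def D_def by blast
  have "card I < card U" using less by (simp add: U_def card_coords)
  then obtain x where x: "\<exists>u\<in>U. x u \<noteq> 0" "\<And>i. i \<in> I \<Longrightarrow> dot U (tw (H i)) x = 0"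
    using kernel_exists[of I U 0 "\<lambda>i. tw (H i)"] fin prime_like_0 by auto
  define v where "v = (\<lambda>u. if u \<in> U then x u else 0)"
  have v0: "v u = 0" if "u \<in> coords {..<n} - coords T" for u
    using that by (simp add: v_def U_def)
  have omv: "om n v y = dot U (tw y) x" for y
  proof -
    have "om n v y = dot U v (tw y)" unfolding U_def using T v0 by (rule om_supported)
    also have "\<dots> = dot U x (tw y)" by (rule dot_cong) (simp add: v_def)
    finally show ?thesis by (simp add: dot_comm)
  qed
  have omv0: "om n v y = 0" if "\<And>u. u \<in> U \<Longrightarrow> y u = 0" for y
  proof -
    have "tw y u = 0" if "u \<in> U" for u
      using that \<open>\<And>u. u \<in> U \<Longrightarrow> y u = 0\<close> by (cases u) (auto simp: tw_def U_def coords_def)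
    then show ?thesis by (simp add: omv dot_def)
  qed
  have "\<not> {1..m} \<subseteq> I"
    using less card_mono[of I "{1..m}"] fin by auto
  then obtain j where j: "j \<in> {1..m} - I" by blast
  obtain c where c: "c j \<noteq> 0" "\<And>u. u \<in> U \<Longrightarrow> (\<Sum>i\<in>insert j I. c i * H i u) = 0"
    using maximal_indep_dependent[OF _ I j] by (auto simp: U_def)
  define l where "l = (\<lambda>u. \<Sum>i\<in>insert j I. c i * H i u)"
  have lU: "l u = 0" if "u \<in> U" for u using c that by (simp add: l_def)
  \<comment> \<open>\<open>l\<close> vanishes on the support of \<open>v\<close> and has a nonzero
    coefficient at \<open>H j\<close>, so orthogonality of \<open>v\<close> to the rows in
    \<open>I\<close> extends to row \<open>j\<close>.\<close>
  have omvH: "om n v (H i) = 0" if "i \<in> insert j I" for i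
  proof (cases "i = j")
    case True
    have "0 = om n v l" using lU by (simp add: omv0)
    also have "\<dots> = c j * om n v (H j)"
      unfolding l_def om_linear_right using j fin x by (simp add: omv)
    finally show ?thesis using c True by simp
  qed (use that x in \<open>auto simp: omv\<close>)
  have el: "a = 0 \<and> b = 0" if ab: "\<And>u. u \<in> coords {..<n} \<Longrightarrow> a * H 0 u + b * l u = 0" for a b
  proof -
    define f where "f = (\<lambda>i. if i = 0 then a else if i \<in> insert j I then b * c i else 0)"
    have "0 dvd f i" if i: "i \<le> m" for i
    proof (rule indepD[OF ind])
      fix u assume u: "u \<in> coords {..<n}"
      have jI: "insert j I \<subseteq> {1..m}" using I j by auto
      have "{..m} = insert 0 {1..m}" by auto
      then have "(\<Sum>i\<le>m. f i * H i u) = a * H 0 u + (\<Sum>i\<in>{1..m}. f i * H i u)"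
        by (simp add: f_def)
      also have "(\<Sum>i\<in>{1..m}. f i * H i u) = (\<Sum>i\<in>insert j I. b * c i * H i u)"
        using jI by (intro sum.mono_neutral_cong_right) (auto simp: f_def)
      also have "\<dots> = b * l u" by (simp only: l_def sum_distrib_left mult.assoc)
      finally show "0 dvd (\<Sum>i\<le>m. f i * H i u)" using ab u by simp
    qed (use i in auto)
    then have "f 0 = 0" "f j = 0" using j by auto
    then show ?thesis using j c by (auto simp: f_def split: if_splits)
  qed
  have ev: "a = 0 \<and> b = 0" if ab: "\<And>u. u \<in> coords {..<n} \<Longrightarrow> a * H 0 u + b * v u = 0" for a b
  proof -
    obtain u where "u \<in> coords {..<n} - coords T" "H 0 u \<noteq> 0" using e by blast
    then have "a = 0" using ab[of u] v0[of u] by simp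
    moreover obtain u' where "u' \<in> U" "x u' \<noteq> 0" using x by blast
    ultimately show ?thesis using ab[of u'] UD by (auto simp: D_def v_def)
  qed
  obtain w1 where w1: "om n (H 0) w1 = 0" "om n l w1 \<noteq> 0" using separating_vector[of n "H 0" l] el by blast
  obtain w2 where w2: "om n (H 0) w2 = 0" "om n v w2 \<noteq> 0" using separating_vector[of n "H 0" v] ev by blast
  \<comment> \<open>If \<open>w1\<close> is orthogonal to \<open>v\<close> and \<open>w2\<close> to
    \<open>l\<close>, their sum pairs nontrivially with both; otherwise one of them already
    does.\<close>
  obtain w where w: "om n (H 0) w = 0" "om n l w \<noteq> 0" "om n v w \<noteq> 0"
  proof (cases "om n v w1 = 0 \<and> om n l w2 = 0")
    case True
    then show ?thesis using w1 w2 by (intro that[of "\<lambda>u. w1 u + w2 u"]) (auto simp: om_linear_right)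
  qed (use w1 w2 that in blast)
  have "indep 0 (insert j I) U (\<lambda>i. transv n C w (H i))" if "C \<noteq> 0" for C
    unfolding indep_def
  proof (intro allI impI)
    fix b assume b: "\<forall>u\<in>U. 0 dvd (\<Sum>i\<in>insert j I. b i * transv n C w (H i) u)"
    define y where "y = (\<lambda>u. \<Sum>i\<in>insert j I. b i * H i u)"
    have "(\<Sum>i\<in>insert j I. b i * transv n C w (H i) u) = transv n C w y u" for u
      unfolding transv_def y_def om_linear_left
      by (simp only: distrib_left sum.distrib sum_distrib_left sum_distrib_right mult.assoc mult.left_commute)
    then have ty: "transv n C w y u = 0" if "u \<in> U" for u using b that by auto
    have vy: "om n v y = 0" unfolding y_def om_linear_right using omvH by (simp add: sum.neutral)
    have "0 = om n v (transv n C w y)" using ty by (simp add: omv0)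
    also have "\<dots> = C * om n y w * om n v w"
      using vy by (simp add: transv_def om_linear_right)
    finally have yw: "om n y w = 0" using w \<open>C \<noteq> 0\<close> by simp
    then have yU: "y u = 0" if "u \<in> U" for u using ty[OF that] by (simp add: transv_def)
    \<comment> \<open>Cancelling row \<open>j\<close> between \<open>y\<close> and \<open>l\<close>,
      which both vanish on \<open>T\<close>, leaves a relation among the rows in \<open>I\<close>,
      independent there.\<close>
    have proportional: "c j * b i - b j * c i = 0" if "i \<in> I" for i
    proof -
      have "0 dvd c j * b i - b j * c i"
      proof (rule indepD[OF I(2) _ that])
        fix u assume "u \<in> coords T"
        then have "c j * y u - b j * l u = 0" using yU lU by (simp add: U_def)
        then have "(\<Sum>i\<in>I. (c j * b i - b j * c i) * H i u) = 0"
          using fin j by (simp add: y_def l_def algebra_simps sum_subtractf sum_distrib_left)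
        then show "0 dvd (\<Sum>i\<in>I. (c j * b i - b j * c i) * H i u)" by simp
      qed
      then show ?thesis by simp
    qed
    have "c j * b i = b j * c i" if "i \<in> insert j I" for i using proportional that by auto
    then have "c j * om n y w = b j * om n l w"
      unfolding y_def l_def om_linear_left sum_distrib_left mult.assoc[symmetric]
      by (intro sum.cong) auto
    then have "b j = 0" using yw w by simp
    then show "\<forall>i\<in>insert j I. 0 dvd b i" using proportional c by auto
  qed
  moreover have "card (insert j I) = Suc (card I)" "insert j I \<subseteq> {1..m}" using j fin I by auto
  ultimately show ?thesis using w unfolding U_def by blast
qed


text \<open>Index 0 is reserved for the logical error and does not count. Modulus 0 makes this the
  rational rank of the generators restricted to \<open>T\<close>.\<close>

definition rk :: "nat \<Rightarrow> nat set \<Rightarrow> (nat \<Rightarrow> nat \<times> bool \<Rightarrow> int) \<Rightarrow> nat" where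
  "rk m T H = Max (card ` {I. I \<subseteq> {1..m} \<and> indep 0 I (coords T) H})"

lemma rk_ge:
  assumes "I \<subseteq> {1..m}" "indep 0 I (coords T) H"
  shows "card I \<le> rk m T H"
  unfolding rk_def by (rule Max_ge) (use assms in auto)

lemma rk_attained: "\<exists>I\<subseteq>{1..m}. indep 0 I (coords T) H \<and> card I = rk m T H"
proof -
  have "{} \<in> {I. I \<subseteq> {1..m} \<and> indep 0 I (coords T) H}" by (simp add: indep_def)
  then have "rk m T H \<in> card ` {I. I \<subseteq> {1..m} \<and> indep 0 I (coords T) H}"
    unfolding rk_def by (intro Max_in) auto
  then show ?thesis by auto
qed

lemma rk_le: "rk m T H \<le> m"
proof -
  obtain I where "I \<subseteq> {1..m}" "card I = rk m T H" using rk_attained by blast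
  then show ?thesis using card_mono[of "{1..m}" I] by simp
qed

text \<open>At a lift of maximal total rank, \<open>small\<close> leaves a generator outside any
  independent set smaller than \<open>2 * card T\<close>, and \<open>e\<close> keeps row 0 from
  being supported on \<open>T\<close>: what \<open>rank_increase\<close> asks for.\<close>

lemma full_rank_lift:
  assumes q: "prime q" and ind: "indep q {..m} (coords {..<n}) h"
    and iso: "\<And>i j. i \<le> m \<Longrightarrow> j \<le> m \<Longrightarrow> q dvd om n (h i) (h j)"
    and small: "\<And>T. T \<subseteq> {..<n} \<Longrightarrow> card T < d \<Longrightarrow> 2 * card T \<le> m"
    and e: "\<And>T. T \<subseteq> {..<n} \<Longrightarrow> card T < d \<Longrightarrow> \<exists>u\<in>coords {..<n} - coords T. h 0 u \<noteq> 0"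
  shows "\<exists>H K. H 0 = h 0 \<and>
      (\<forall>i\<le>m. \<not> q dvd K i \<and> (\<forall>u\<in>coords {..<n}. q dvd H i u - K i * h i u)) \<and>
      (\<forall>i\<le>m. \<forall>j\<le>m. om n (H i) (H j) = 0) \<and>
      (\<forall>T\<subseteq>{..<n}. card T < d \<longrightarrow>
        (\<exists>I\<subseteq>{1..m}. indep 0 I (coords T) H \<and> 2 * card T \<le> card I))"
proof -
  note pq = prime_like_prime[OF q]
  obtain H0 K where H0: "H0 0 = h 0" and K: "\<forall>i\<le>m. \<not> q dvd K i"
    and "\<forall>i\<le>m. \<forall>u\<in>coords {..<n}. q dvd H0 i u - K i * h i u"
      "\<forall>i\<le>m. \<forall>j\<le>m. om n (H0 i) (H0 j) = 0"
    using isotropic_lift[OF pq ind iso] by blast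
  \<comment> \<open>The factors \<open>K\<close> are fixed once, so that competing lifts agree
    modulo \<open>q\<close> and transvections trivial modulo \<open>q\<close> stay among
    them.\<close>
  define lift where "lift = (\<lambda>H. H 0 = h 0 \<and>
    (\<forall>i\<le>m. \<forall>u\<in>coords {..<n}. q dvd H i u - K i * h i u) \<and> (\<forall>i\<le>m. \<forall>j\<le>m. om n (H i) (H j) = 0))"
  define pot where "pot = (\<lambda>H. \<Sum>T\<in>Pow {..<n}. rk m T H)"
  have "lift H0" using H0 \<open>\<forall>i\<le>m. \<forall>u\<in>_. _\<close> \<open>\<forall>i\<le>m. \<forall>j\<le>m. _\<close> by (simp add: lift_def)
  moreover have "pot H < Suc (\<Sum>T\<in>Pow {..<n}. m)" for H
    unfolding pot_def by (intro le_imp_less_Suc sum_mono rk_le)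
  ultimately obtain H where H: "lift H" and max: "\<And>H'. lift H' \<Longrightarrow> pot H' \<le> pot H"
    using ex_has_greatest_nat[of lift H0 pot] by blast
  have HK: "\<And>i u. i \<le> m \<Longrightarrow> u \<in> coords {..<n} \<Longrightarrow> q dvd H i u - K i * h i u"
    using H unfolding lift_def by blast
  have "indep q {..m} (coords {..<n}) H"
    by (rule indep_cong_mod[OF _ _ pq ind HK]) (use K in auto)
  then have indH: "indep 0 {..m} (coords {..<n}) H" using pq by (intro indep_imp_indep_0) auto
  have ranks: "\<exists>I\<subseteq>{1..m}. indep 0 I (coords T) H \<and> 2 * card T \<le> card I"
    if T: "T \<subseteq> {..<n}" "card T < d" for T
  proof (rule ccontr)
    assume contra: "\<not> ?thesis"
    obtain I where I: "I \<subseteq> {1..m}" "indep 0 I (coords T) H" "card I = rk m T H"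
      using rk_attained by blast
    then have less: "card I < 2 * card T" using contra by force
    have "\<exists>w. om n (H 0) w = 0 \<and> (\<forall>C. C \<noteq> 0 \<longrightarrow>
      (\<exists>J\<subseteq>{1..m}. card J = Suc (card I) \<and> indep 0 J (coords T) (\<lambda>i. transv n C w (H i))))"
    proof (rule rank_increase[OF indH T(1) I(1,2) _ less])
      show "\<exists>u\<in>coords {..<n} - coords T. H 0 u \<noteq> 0" using e[OF T] H by (simp add: lift_def)
      show "card I < m" using less small[OF T] by simp
      show "\<forall>J\<subseteq>{1..m}. indep 0 J (coords T) H \<longrightarrow> card J \<le> card I"
        using rk_ge I(3) by metis
    qed
    then obtain w where w: "om n (H 0) w = 0" and J: "\<And>C. C \<noteq> 0 \<Longrightarrow>
      \<exists>J\<subseteq>{1..m}. card J = Suc (card I) \<and> indep 0 J (coords T) (\<lambda>i. transv n C w (H i))"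
      by blast
    have "\<forall>S\<in>Pow {..<n}. \<exists>N::nat. \<forall>p::int. prime p \<and> p > int N \<longrightarrow>
      (\<forall>A'. (\<forall>i\<le>m. \<forall>u\<in>coords S. p dvd A' i u - H i u) \<longrightarrow> rk m S H \<le> rk m S A')"
    proof
      fix S :: "nat set" assume "S \<in> Pow {..<n}"
      then have fin: "finite (coords S)" by (auto intro!: finite_coords intro: finite_subset)
      obtain I' where I': "I' \<subseteq> {1..m}" "indep 0 I' (coords S) H" "card I' = rk m S H"
        using rk_attained by blast
      then have "finite I'" by (auto intro: finite_subset)
      then obtain N :: nat where N: "\<forall>p::int. prime p \<and> p > int N \<longrightarrow>
        (\<forall>A'. (\<forall>i\<in>I'. \<forall>u\<in>coords S. p dvd A' i u - H i u) \<longrightarrow> indep 0 I' (coords S) A')"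
        using indep_0_stable[OF _ fin I'(2)] by blast
      have "rk m S H \<le> rk m S A'" if "prime p" "p > int N"
        "\<forall>i\<le>m. \<forall>u\<in>coords S. p dvd A' i u - H i u" for p :: int and A'
      proof -
        have "\<forall>i\<in>I'. \<forall>u\<in>coords S. p dvd A' i u - H i u" using that(3) I'(1) by auto
        then have "indep 0 I' (coords S) A'" using N that(1,2) by blast
        then show ?thesis using rk_ge I' by metis
      qed
      then show "\<exists>N::nat. \<forall>p::int. prime p \<and> p > int N \<longrightarrow>
        (\<forall>A'. (\<forall>i\<le>m. \<forall>u\<in>coords S. p dvd A' i u - H i u) \<longrightarrow> rk m S H \<le> rk m S A')" by blast
    qed
    from bchoice[OF this] obtain N :: "nat set \<Rightarrow> nat" where N0:
      "\<forall>S\<in>Pow {..<n}. \<forall>p::int. prime p \<and> p > int (N S) \<longrightarrow>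
        (\<forall>A'. (\<forall>i\<le>m. \<forall>u\<in>coords S. p dvd A' i u - H i u) \<longrightarrow> rk m S H \<le> rk m S A')"
      by (elim exE) (rule that)
    have N: "rk m S H \<le> rk m S A'" if "S \<subseteq> {..<n}" "prime p" "p > int (N S)"
      "\<forall>i\<le>m. \<forall>u\<in>coords S. p dvd A' i u - H i u" for S A' and p :: int
      by (rule N0[THEN bspec, THEN spec[of _ p], THEN mp, THEN spec, THEN mp, OF _ _ that(4)])
        (use that in auto)
    \<comment> \<open>One prime beyond the thresholds of all the finitely many sets
      \<open>S\<close>, so that no rank on any of them drops.\<close>
    obtain p0 :: nat where p0: "prime p0" "p0 > Max (N ` Pow {..<n})"
      using bigger_prime[of "Max (N ` Pow {..<n})"] by blast
    define p where "p = int p0"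
    have p: "prime p" "p > int (N S)" if "S \<subseteq> {..<n}" for S
    proof -
      have "N S \<le> Max (N ` Pow {..<n})" using that by (intro Max_ge) auto
      then show "p > int (N S)" using p0 by (simp add: p_def)
    qed (use p0 in \<open>simp add: p_def\<close>)
    define H' where "H' = (\<lambda>i. transv n (q * p) w (H i))"
    have H': "q dvd H' i u - H i u" "p dvd H' i u - H i u" for i u
      by (simp_all add: H'_def transv_def)
    have "lift H'"
      unfolding lift_def
    proof (intro conjI allI impI ballI)
      have "H' 0 = H 0" using w by (simp add: H'_def transv_def)
      then show "H' 0 = h 0" using H by (simp add: lift_def)
      fix i assume i: "i \<le> m"
      show "om n (H' i) (H' j) = 0" if "j \<le> m" for j
        using H i that by (simp add: H'_def om_transv lift_def)
      fix u assume "u \<in> coords {..<n}"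
      then show "q dvd H' i u - K i * h i u"
        using dvd_add[OF H'(1)[of i u] HK[OF i, of u]] by simp
    qed
    then have "pot H' \<le> pot H" by (rule max)
    moreover have "pot H < pot H'"
      unfolding pot_def
    proof (rule sum_strict_mono_ex1)
      show "\<forall>S\<in>Pow {..<n}. rk m S H \<le> rk m S H'"
      proof
        fix S assume "S \<in> Pow {..<n}"
        then have S: "S \<subseteq> {..<n}" by simp
        show "rk m S H \<le> rk m S H'"
          by (rule N[OF S p(1)[OF S] p(2)[OF S]]) (use H'(2) in blast)
      qed
      have "q * p \<noteq> 0" using q p(1)[of "{}"] not_prime_0 by fastforce
      then obtain J where "J \<subseteq> {1..m}" "card J = Suc (card I)" "indep 0 J (coords T) H'"
        using J unfolding H'_def by blast
      then have "rk m T H < rk m T H'" using rk_ge[of J m T H'] I(3) by simp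
      then show "\<exists>S\<in>Pow {..<n}. rk m S H < rk m S H'" using T by blast
    qed simp
    ultimately show False by simp
  qed
  have "\<forall>i\<le>m. \<not> q dvd K i \<and> (\<forall>u\<in>coords {..<n}. q dvd H i u - K i * h i u)"
    using K HK by blast
  moreover have "H 0 = h 0" "\<forall>i\<le>m. \<forall>j\<le>m. om n (H i) (H j) = 0"
    using H by (simp_all add: lift_def)
  ultimately show ?thesis
    using ranks by (intro exI[of _ H] exI[of _ K] conjI allI impI) simp_all
qed

section \<open>Real coefficients\<close>

text \<open>Pairing with the integer dual family isolates real coefficients just as well, so
  rational independence of integer rows passes to the reals.\<close>

lemma real_comb_zero:
  fixes c :: "'i \<Rightarrow> real"
  assumes "finite I" "finite U" "indep 0 I U A"
    and "\<And>u. u \<in> U \<Longrightarrow> (\<Sum>i\<in>I. c i * of_int (A i u)) = 0" and b: "b \<in> I"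
  shows "c b = 0"
proof -
  obtain F N where N: "N \<noteq> 0" and F: "dual_family I U A F N"
    using dual_of_indep[OF assms(1,2) prime_like_0 assms(3)] by auto
  have "0 = (\<Sum>u\<in>U. (\<Sum>i\<in>I. c i * of_int (A i u)) * of_int (F b u))"
    using assms(4) by simp
  also have "\<dots> = (\<Sum>i\<in>I. \<Sum>u\<in>U. c i * of_int (A i u) * of_int (F b u))"
    unfolding sum_distrib_right by (rule sum.swap)
  also have "\<dots> = (\<Sum>i\<in>I. c i * of_int (dot U (A i) (F b)))"
    by (simp add: dot_def sum_distrib_left mult.assoc)
  also have "\<dots> = (\<Sum>i\<in>I. if i = b then c i * of_int N else 0)"
    using F b by (intro sum.cong) (auto simp: dual_family_def)
  also have "\<dots> = c b * of_int N" using assms(1) b by simp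
  finally show ?thesis using N by simp
qed

text \<open>With as many independent rows as coordinates, a nonzero integer multiple of the unit row
  at \<open>v\<close> is a combination of the rows, all of which annihilate
  \<open>w\<close>.\<close>

lemma full_rank_real_kernel:
  fixes w :: "'u \<Rightarrow> real"
  assumes fin: "finite I" "finite U" and ind: "indep 0 I U A" and card: "card U \<le> card I"
    and w: "\<And>i. i \<in> I \<Longrightarrow> (\<Sum>u\<in>U. w u * of_int (A i u)) = 0" and v: "v \<in> U"
  shows "w v = 0"
proof -
  define E where "E = insert None (Some ` I)"
  \<comment> \<open>\<open>None\<close> stands for the negated unit row at \<open>v\<close>; every
    nontrivial relation involves it, since the rows in \<open>I\<close> are independent.\<close>
  define B where "B = (\<lambda>u s. case s of None \<Rightarrow> if u = v then -1 else 0 | Some i \<Rightarrow> A i u)"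
  have "card U < card E" using fin card by (simp add: E_def card_image)
  then obtain x where x: "\<exists>s\<in>E. x s \<noteq> 0" and Bx: "\<And>u. u \<in> U \<Longrightarrow> dot E (B u) x = 0"
    using kernel_exists[of U E 0 B] fin prime_like_0 by (auto simp: E_def)
  have eq: "(\<Sum>i\<in>I. x (Some i) * A i u) = (if u = v then x None else 0)" if "u \<in> U" for u
    using Bx[OF that] fin by (auto simp: dot_def E_def B_def sum.reindex mult.commute)
  have "x None \<noteq> 0"
  proof
    assume 0: "x None = 0"
    have "0 dvd x (Some i)" if "i \<in> I" for i
      by (rule indepD[OF ind _ that]) (simp add: eq 0)
    then show False using x 0 by (auto simp: E_def)
  qed
  have "0 = (\<Sum>i\<in>I. of_int (x (Some i)) * (\<Sum>u\<in>U. w u * of_int (A i u)))" using w by simp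
  also have "\<dots> = (\<Sum>u\<in>U. \<Sum>i\<in>I. of_int (x (Some i)) * (w u * of_int (A i u)))"
    unfolding sum_distrib_left by (rule sum.swap)
  also have "\<dots> = (\<Sum>u\<in>U. w u * of_int (\<Sum>i\<in>I. x (Some i) * A i u))"
    by (simp add: sum_distrib_left mult.left_commute)
  also have "\<dots> = (\<Sum>u\<in>U. if u = v then w u * of_int (x None) else 0)"
    by (rule sum.cong) (simp_all add: eq)
  also have "\<dots> = w v * of_int (x None)" using fin v by simp
  finally show ?thesis using \<open>x None \<noteq> 0\<close> by simp
qed

section \<open>Stabilizer codes\<close>

definition vec_of :: "int pvec \<Rightarrow> nat \<times> bool \<Rightarrow> int" where
  "vec_of x = (\<lambda>(t, b). if b then snd x t else fst x t)"

definition pvec_of :: "(nat \<times> bool \<Rightarrow> int) \<Rightarrow> int pvec" where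
  "pvec_of v = (\<lambda>t. v (t, False), \<lambda>t. v (t, True))"

lemma vec_of_pvec_of [simp]: "vec_of (pvec_of v) = v"
  by (auto simp: vec_of_def pvec_of_def)

lemma sympl_eq_om: "sympl n x y = om n (vec_of x) (vec_of y)"
  by (simp add: sympl_def om_eq vec_of_def)

lemma ball_coords: "(\<forall>u\<in>coords {..<n}. P u) \<longleftrightarrow> (\<forall>t<n. P (t, False) \<and> P (t, True))"
  by (auto simp: coords_def) (metis (full_types))

lemma in_stab_iff:
  "in_stab q n G x \<longleftrightarrow>
    (\<exists>c. \<forall>u\<in>coords {..<n}. q dvd vec_of x u - (\<Sum>i<length G. c i * vec_of (G ! i) u))"
  by (simp add: in_stab_def ball_coords vec_of_def cong_iff_dvd_diff)

lemma indep_mod_iff: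
  "indep_mod q n G \<longleftrightarrow> indep q {..<length G} (coords {..<n}) (\<lambda>i. vec_of (G ! i))"
  by (simp add: indep_mod_def indep_def ball_coords vec_of_def cong_0_iff) auto

lemma inverse_mod_prime:
  assumes "prime (q::int)" "\<not> q dvd k"
  shows "\<exists>k'. q dvd k' * k - 1"
proof -
  have "coprime k q" using assms prime_imp_coprime coprime_commute by blast
  then obtain k' where "[k * k' = 1] (mod q)" using cong_solve_coprime_int by blast
  then show ?thesis by (auto simp: cong_iff_dvd_diff mult.commute)
qed

lemma span_mod_rescale:
  assumes "\<And>i u. i < (m::nat) \<Longrightarrow> u \<in> U \<Longrightarrow> (q::int) dvd B i u - K i * A i u"
    and "\<exists>c. \<forall>u\<in>U. q dvd x u - (\<Sum>i<m. c i * B i u)"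
  shows "\<exists>c. \<forall>u\<in>U. q dvd x u - (\<Sum>i<m. c i * A i u)"
proof -
  obtain c where c: "\<forall>u\<in>U. q dvd x u - (\<Sum>i<m. c i * B i u)" using assms(2) by blast
  have "q dvd x u - (\<Sum>i<m. c i * K i * A i u)" if "u \<in> U" for u
  proof -
    have "q dvd (\<Sum>i<m. c i * (B i u - K i * A i u))"
      using assms(1) that by (intro dvd_sum dvd_mult) auto
    then have "q dvd (\<Sum>i<m. c i * B i u) - (\<Sum>i<m. c i * K i * A i u)"
      by (simp add: right_diff_distrib sum_subtractf mult.assoc)
    then show ?thesis using dvd_add[of q "x u - (\<Sum>i<m. c i * B i u)"] c that by fastforce
  qed
  then show ?thesis by (intro exI[of _ "\<lambda>i. c i * K i"]) auto
qed

text \<open>Reducing \<open>v\<close> modulo \<open>q\<close> keeps its zeros and yields a commuting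
  Pauli of weight below \<open>d\<close>; minimality of \<open>d\<close> puts it into the
  stabilizer.\<close>

lemma distance_span:
  assumes q: "prime q" and d: "code_distance q n G d"
    and T: "T \<subseteq> {..<n}" "card T < d"
    and v0: "\<And>u. u \<in> coords {..<n} - coords T \<Longrightarrow> v u = 0"
    and v: "\<And>i. i < length G \<Longrightarrow> q dvd om n v (vec_of (G ! i))"
  shows "\<exists>c. \<forall>u\<in>coords {..<n}. q dvd v u - (\<Sum>i<length G. c i * vec_of (G ! i) u)"
proof -
  define x where "x = pvec_of (\<lambda>u. v u mod q)"
  have q0: "q > 0" using q by (simp add: prime_gt_0_int)
  have vx: "q dvd vec_of x u - v u" for u
    by (simp add: x_def mod_eq_dvd_iff[symmetric])
  have xv: "q dvd v u - vec_of x u" for u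
    using vx dvd_diff_commute by blast
  have "is_pauli q n x" using q0 by (simp add: is_pauli_def x_def pvec_of_def)
  moreover have "\<forall>g\<in>set G. [sympl n x g = 0] (mod q)"
  proof
    fix g assume "g \<in> set G"
    then obtain i where i: "i < length G" "g = G ! i" by (auto simp: in_set_conv_nth)
    have "q dvd om n (vec_of x) (vec_of g) - om n v (vec_of g)" using vx by (rule om_cong_mod_left)
    then have "q dvd om n (vec_of x) (vec_of g)" using v i by (metis diff_add_cancel dvd_add)
    then show "[sympl n x g = 0] (mod q)" by (simp add: sympl_eq_om cong_0_iff)
  qed
  moreover have "wt n x < d"
  proof -
    have "{t. t < n \<and> (fst x t \<noteq> 0 \<or> snd x t \<noteq> 0)} \<subseteq> T"
      using v0 by (force simp: x_def pvec_of_def coords_def)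
    then have "wt n x \<le> card T" unfolding wt_def using T finite_subset by (intro card_mono) auto
    then show ?thesis using T by simp
  qed
  ultimately have "in_stab q n G x" using d
    unfolding code_distance_def logical_q_def by (meson not_less)
  then obtain c where "\<forall>u\<in>coords {..<n}. q dvd vec_of x u - (\<Sum>i<length G. c i * vec_of (G ! i) u)"
    by (auto simp: in_stab_iff)
  then have "q dvd (v u - vec_of x u) + (vec_of x u - (\<Sum>i<length G. c i * vec_of (G ! i) u))"
    if "u \<in> coords {..<n}" for u
    using dvd_add[OF xv] that by blast
  then have "\<forall>u\<in>coords {..<n}. q dvd v u - (\<Sum>i<length G. c i * vec_of (G ! i) u)" by simp
  then show ?thesis by blast
qed


text \<open>A relation with \<open>c 0\<close> invertible modulo \<open>q\<close> would put
  \<open>e\<close> into the stabilizer; otherwise it reduces to a relation among the generators,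
  which sit one index higher than in \<open>G\<close>.\<close>

lemma logical_indep:
  assumes q: "prime q" and G: "indep_mod q n G" and e: "\<not> in_stab q n G e"
  shows "indep q {..length G} (coords {..<n}) (\<lambda>i. if i = 0 then vec_of e else vec_of (G ! (i - 1)))"
    (is "indep q _ ?D ?h")
  unfolding indep_def
proof (intro allI impI)
  fix c assume c: "\<forall>u\<in>?D. q dvd (\<Sum>i\<le>length G. c i * ?h i u)"
  have c': "q dvd c 0 * vec_of e u + (\<Sum>i<length G. c (Suc i) * vec_of (G ! i) u)" if "u \<in> ?D" for u
    using c that by (simp add: sum.atMost_shift)
  have c0: "q dvd c 0"
  proof (rule ccontr)
    assume "\<not> q dvd c 0"
    then obtain k where k: "q dvd k * c 0 - 1" using inverse_mod_prime q by blast
    have "q dvd vec_of e u - (\<Sum>i<length G. (- k * c (Suc i)) * vec_of (G ! i) u)" if "u \<in> ?D" for u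
    proof -
      have "q dvd k * (c 0 * vec_of e u + (\<Sum>i<length G. c (Suc i) * vec_of (G ! i) u))
          - (k * c 0 - 1) * vec_of e u"
        using c'[OF that] k by (intro dvd_diff) auto
      then show ?thesis by (simp add: algebra_simps sum_distrib_left sum_negf)
    qed
    then have "in_stab q n G e"
      unfolding in_stab_iff by (intro exI[of _ "\<lambda>i. - k * c (Suc i)"] ballI)
    then show False using e by simp
  qed
  have cS: "q dvd c (Suc i)" if "i < length G" for i
  proof (rule indepD[OF G[unfolded indep_mod_iff], where c = "\<lambda>i. c (Suc i)"])
    fix u assume "u \<in> ?D"
    then show "q dvd (\<Sum>i<length G. c (Suc i) * vec_of (G ! i) u)"
      using c' c0 by (simp add: dvd_add_right_iff)
  qed (use that in simp)
  show "\<forall>i\<in>{..length G}. q dvd c i"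
  proof
    fix i assume "i \<in> {..length G}"
    then show "q dvd c i" using c0 cS[of "i - 1"] by (cases i) auto
  qed
qed

lemma min_logical_lift:
  assumes q: "prime q" and stab: "is_stab_code q n k G" and d: "code_distance q n G d"
    and e: "logical_q q n G e" "wt n e = d"
  shows "\<exists>H K. H 0 = vec_of e \<and> indep 0 {..length G} (coords {..<n}) H \<and>
      (\<forall>i<length G. \<not> q dvd K i \<and>
         (\<forall>u\<in>coords {..<n}. q dvd H (Suc i) u - K i * vec_of (G ! i) u)) \<and>
      (\<forall>i\<le>length G. \<forall>j\<le>length G. om n (H i) (H j) = 0) \<and>
      (\<forall>T\<subseteq>{..<n}. card T < d \<longrightarrow>
        (\<exists>I\<subseteq>{1..length G}. indep 0 I (coords T) H \<and> 2 * card T \<le> card I))"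
proof -
  note pq = prime_like_prime[OF q]
  define m where "m = length G"
  define h where "h = (\<lambda>i. if i = 0 then vec_of e else vec_of (G ! (i - 1)))"
  have ind: "indep q {..m} (coords {..<n}) h"
    unfolding m_def h_def using stab e
    by (intro logical_indep q) (auto simp: is_stab_code_def logical_q_def)
  have GG: "q dvd om n (vec_of x) (vec_of y)" if "x \<in> set G" "y \<in> set G" for x y
    using stab that by (auto simp: is_stab_code_def sympl_eq_om cong_0_iff)
  have eG: "q dvd om n (vec_of e) (vec_of x)" if "x \<in> set G" for x
    using e that by (auto simp: logical_q_def sympl_eq_om cong_0_iff)
  have Ge: "q dvd om n (vec_of x) (vec_of e)" if "x \<in> set G" for x
    using eG[OF that] om_antisym[of n "vec_of x" "vec_of e"] by simp
  have iso: "q dvd om n (h i) (h j)" if "i \<le> m" "j \<le> m" for i j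
    using that GG eG Ge by (auto simp: h_def om_self m_def)
  \<comment> \<open>The logical error extends the generators to a larger independent isotropic
    family, so at least one logical register exists, as the Singleton bound requires.\<close>
  have "Suc m \<le> n"
    by (rule isotropic_indep_card[OF pq, of _ n h]) (use ind iso in \<open>auto simp: lessThan_Suc_atMost\<close>)
  have ind1: "indep q {1..m} (coords {..<n}) h" by (rule indep_subset[OF ind]) auto
  have small: "2 * card T \<le> m" if T: "T \<subseteq> {..<n}" "card T < d" for T
  proof -
    have "2 * card T \<le> card {1..m}"
    proof (rule singleton_bound[OF pq _ ind1])
      fix S and v :: "nat \<times> bool \<Rightarrow> int"
      assume S: "S \<subseteq> {..<n}" "card S \<le> card T"
        and v0: "\<And>u. u \<in> coords {..<n} - coords S \<Longrightarrow> v u = 0"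
        and v: "\<And>i. i \<in> {1..m} \<Longrightarrow> q dvd om n v (h i)"
      have "q dvd om n v (vec_of (G ! i))" if "i < length G" for i
        using v[of "Suc i"] that by (simp add: h_def m_def)
      then obtain c where "\<forall>u\<in>coords {..<n}. q dvd v u - (\<Sum>i<length G. c i * vec_of (G ! i) u)"
        using distance_span[OF q d S(1) _ v0] S T by fastforce
      then show "\<exists>c. \<forall>u\<in>coords {..<n}. q dvd v u - (\<Sum>i\<in>{1..m}. c i * h i u)"
        by (intro exI[of _ "\<lambda>i. c (i - 1)"]) (simp add: sum.atLeast1_atMost_eq m_def h_def)
    qed (use \<open>Suc m \<le> n\<close> in auto)
    then show ?thesis by simp
  qed
  \<comment> \<open>\<open>e\<close> has weight \<open>d\<close>, so its support does not fit into
    fewer than \<open>d\<close> registers.\<close>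
  have outside: "\<exists>u\<in>coords {..<n} - coords T. h 0 u \<noteq> 0" if T: "T \<subseteq> {..<n}" "card T < d" for T
  proof (rule ccontr)
    assume *: "\<not> ?thesis"
    have "{t. t < n \<and> (fst e t \<noteq> 0 \<or> snd e t \<noteq> 0)} \<subseteq> T"
    proof
      fix t assume t: "t \<in> {t. t < n \<and> (fst e t \<noteq> 0 \<or> snd e t \<noteq> 0)}"
      show "t \<in> T"
      proof (rule ccontr)
        assume "t \<notin> T"
        then have "(t, b) \<in> coords {..<n} - coords T" for b using t by (auto simp: coords_def)
        then have "h 0 (t, False) = 0" "h 0 (t, True) = 0" using * by blast+
        then show False using t by (auto simp: h_def vec_of_def)
      qed
    qed
    then have "wt n e \<le> card T" unfolding wt_def using T finite_subset by (intro card_mono) auto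
    then show False using T e by simp
  qed
  have "\<exists>H K. H 0 = h 0 \<and>
      (\<forall>i\<le>m. \<not> q dvd K i \<and> (\<forall>u\<in>coords {..<n}. q dvd H i u - K i * h i u)) \<and>
      (\<forall>i\<le>m. \<forall>j\<le>m. om n (H i) (H j) = 0) \<and>
      (\<forall>T\<subseteq>{..<n}. card T < d \<longrightarrow>
        (\<exists>I\<subseteq>{1..m}. indep 0 I (coords T) H \<and> 2 * card T \<le> card I))"
    by (rule full_rank_lift[OF q ind iso small outside])
  then obtain H K where H: "H 0 = h 0"
      "\<forall>i\<le>m. \<not> q dvd K i \<and> (\<forall>u\<in>coords {..<n}. q dvd H i u - K i * h i u)"
      "\<forall>i\<le>m. \<forall>j\<le>m. om n (H i) (H j) = 0"
      "\<forall>T\<subseteq>{..<n}. card T < d \<longrightarrow> (\<exists>I\<subseteq>{1..m}. indep 0 I (coords T) H \<and> 2 * card T \<le> card I)"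
    by (elim exE conjE) (rule that)
  have "indep q {..m} (coords {..<n}) H"
    by (rule indep_cong_mod[OF _ _ pq ind, of _ K]) (use H(2) in auto)
  then have indH: "indep 0 {..m} (coords {..<n}) H" using pq by (intro indep_imp_indep_0) auto
  have "\<not> q dvd K (Suc i) \<and> (\<forall>u\<in>coords {..<n}. q dvd H (Suc i) u - K (Suc i) * vec_of (G ! i) u)"
    if "i < m" for i
    using H(2)[rule_format, of "Suc i"] that by (auto simp: h_def)
  then have HK: "\<forall>i<m. \<not> q dvd K (Suc i) \<and>
      (\<forall>u\<in>coords {..<n}. q dvd H (Suc i) u - K (Suc i) * vec_of (G ! i) u)" by blast
  have H0: "H 0 = vec_of e" using H(1) by (simp add: h_def)
  show ?thesis
    unfolding m_def[symmetric]
    by (intro exI[of _ H] exI[of _ "\<lambda>i. K (Suc i)"] conjI H0 indH HK H(3,4))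
qed

text \<open>The \<open>K i\<close> are invertible modulo \<open>q\<close>, so lifted and original
  generators are multiples of each other and generate the same group.\<close>

lemma lift_is_LDI_form:
  assumes q: "prime q" and len: "length L = length G"
    and K: "\<And>i. i < length G \<Longrightarrow> \<not> q dvd K i"
    and L: "\<And>i u. i < length G \<Longrightarrow> u \<in> coords {..<n} \<Longrightarrow>
      q dvd vec_of (L ! i) u - K i * vec_of (G ! i) u"
    and iso: "\<forall>g\<in>set L. \<forall>h\<in>set L. sympl n g h = 0"
  shows "is_LDI_form q n G L"
proof -
  have "\<forall>i. \<exists>k. i < length G \<longrightarrow> q dvd k * K i - 1" using inverse_mod_prime[OF q] K by blast
  then obtain K' where K': "\<And>i. i < length G \<Longrightarrow> q dvd K' i * K i - 1" by metis
  have L': "q dvd vec_of (G ! i) u - K' i * vec_of (L ! i) u"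
    if i: "i < length G" "u \<in> coords {..<n}" for i u
  proof -
    have "q dvd - ((K' i * K i - 1) * vec_of (G ! i) u
        + K' i * (vec_of (L ! i) u - K i * vec_of (G ! i) u))"
      unfolding dvd_minus_iff using K'[OF i(1)] L[OF i] by (intro dvd_add) auto
    then show ?thesis by (simp add: algebra_simps)
  qed
  have "in_stab q n L x \<longleftrightarrow> in_stab q n G x" for x
    unfolding in_stab_iff len
    using span_mod_rescale[of "length G" "coords {..<n}" q "\<lambda>i. vec_of (L ! i)", OF L]
      span_mod_rescale[of "length G" "coords {..<n}" q "\<lambda>i. vec_of (G ! i)", OF L']
    by (intro iffI) assumption+
  then show ?thesis using len iso by (simp add: is_LDI_form_def)
qed

section \<open>From integer errors to real displacements\<close>

lemma sympl_rvec: "sympl n (rvec x) (rvec y) = of_int (sympl n x y)"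
  by (simp add: sympl_def rvec_def)

lemma wt_rvec: "wt n (rvec x) = wt n x"
  by (simp add: wt_def rvec_def)

text \<open>An exact zero product with \<open>L ! i\<close> is, modulo \<open>q\<close>, one with
  \<open>K i\<close> times the generator, and \<open>K i\<close> cancels. This bounds the
  unavoidable distance below by \<open>d\<close>.\<close>

lemma ldi_unavoidable_logical:
  assumes LDI: "is_LDI_form q n G L" and "length L = length G" and q: "prime q"
    and K: "\<And>i. i < length G \<Longrightarrow> \<not> q dvd K i"
    and L: "\<And>i u. i < length G \<Longrightarrow> u \<in> coords {..<n} \<Longrightarrow>
      q dvd vec_of (L ! i) u - K i * vec_of (G ! i) u"
    and x: "unavoidable q n G L x"
  shows "logical_q q n G x"
proof -
  have "q dvd om n (vec_of x) (vec_of (G ! i))" if i: "i < length G" for i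
  proof -
    have "L ! i \<in> set L" using i assms(2) by simp
    then have "om n (vec_of (L ! i)) (vec_of x) = 0"
      using x om_antisym[of n "vec_of (L ! i)"] by (simp add: unavoidable_def sympl_eq_om)
    moreover have "q dvd om n (vec_of (L ! i)) (vec_of x) - om n (\<lambda>u. K i * vec_of (G ! i) u) (vec_of x)"
      using L i by (intro om_cong_mod_left) auto
    ultimately have "q dvd K i * om n (vec_of (G ! i)) (vec_of x)" by (simp add: om_linear_left)
    then have "q dvd om n (vec_of (G ! i)) (vec_of x)" using K[OF i] q by (simp add: prime_dvd_mult_iff)
    then show ?thesis using om_antisym[of n "vec_of x" "vec_of (G ! i)"] by simp
  qed
  then have "[sympl n x (G ! i) = 0] (mod q)" if "i < length G" for i
    using that by (simp add: sympl_eq_om cong_0_iff)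
  then have "\<forall>g\<in>set G. [sympl n x g = 0] (mod q)"
    by (simp add: all_set_conv_all_nth)
  then show ?thesis using x by (simp add: logical_q_def unavoidable_def)
qed

theorem mainTheorem2:
  fixes q :: int and n k d :: nat and G :: "int pvec list"
  assumes "prime q"
    and "is_stab_code q n k G"
    and "code_distance q n G d"
  shows "\<exists>L d'. is_LDI_form q n G L \<and> cv_code_params n k d' L \<and>
           unavoidable_distance q n G L d' \<and> d \<le> d'"
proof -
  define m where "m = length G"
  define D where "D = coords {..<n}"
  obtain e where e: "logical_q q n G e" "wt n e = d"
    using assms(3) by (auto simp: code_distance_def)
  obtain H K where H0: "H 0 = vec_of e" and ind: "indep 0 {..m} D H"
    and HK: "\<forall>i<m. \<not> q dvd K i \<and> (\<forall>u\<in>D. q dvd H (Suc i) u - K i * vec_of (G ! i) u)"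
    and iso: "\<forall>i\<le>m. \<forall>j\<le>m. om n (H i) (H j) = 0"
    and rank: "\<forall>T\<subseteq>{..<n}. card T < d \<longrightarrow>
        (\<exists>I\<subseteq>{1..m}. indep 0 I (coords T) H \<and> 2 * card T \<le> card I)"
    using min_logical_lift[OF assms e, folded m_def D_def] by (elim exE conjE) (rule that)
  \<comment> \<open>Row 0 is dropped: \<open>e\<close> is not a nullifier but the witness for both
    distances.\<close>
  define L where "L = map (\<lambda>i. pvec_of (H (Suc i))) [0..<m]"
  have len: "length L = m" by (simp add: L_def)
  have vL: "vec_of (L ! i) = H (Suc i)" if "i < m" for i using that by (simp add: L_def)
  have setL: "\<exists>i<m. x = L ! i" if "x \<in> set L" for x
    using that len by (auto simp: in_set_conv_nth)
  have isoL: "sympl n g h = 0" if gh: "g \<in> set L" "h \<in> set L" for g h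
  proof -
    obtain i j where "i < m" "j < m" "g = L ! i" "h = L ! j" using setL gh by meson
    then show ?thesis using iso by (simp add: sympl_eq_om vL)
  qed
  have KL: "\<And>i. i < length G \<Longrightarrow> \<not> q dvd K i"
    and HL: "\<And>i u. i < length G \<Longrightarrow> u \<in> coords {..<n} \<Longrightarrow> q dvd vec_of (L ! i) u - K i * vec_of (G ! i) u"
    using HK vL by (auto simp: m_def D_def)
  have LDI: "is_LDI_form q n G L"
    by (rule lift_is_LDI_form[OF assms(1) _ KL HL]) (use len isoL in \<open>auto simp: m_def\<close>)
  have eL: "sympl n e l = 0" if "l \<in> set L" for l
    using setL[OF that] iso vL by (auto simp: sympl_eq_om H0[symmetric])
  have un_e: "unavoidable q n G L e" using e eL by (auto simp: unavoidable_def logical_q_def)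
  have "d \<le> wt n x" if "unavoidable q n G L x" for x
    using ldi_unavoidable_logical[OF LDI _ assms(1) KL HL that] len assms(3)
    unfolding m_def code_distance_def by blast
  then have un: "unavoidable_distance q n G L d"
    using un_e e(2) unfolding unavoidable_distance_def by blast

  \<comment> \<open>Coefficient 0 belongs to \<open>e\<close>. Setting it to 0 gives independence of
    the nullifiers, setting it to -1 shows that \<open>e\<close> is outside their real span.\<close>
  have comb: "c i = 0"
    if c: "\<forall>t<n. c 0 * fst (rvec e) t + (\<Sum>i<m. c (Suc i) * fst (rvec (L ! i)) t) = 0 \<and>
                 c 0 * snd (rvec e) t + (\<Sum>i<m. c (Suc i) * snd (rvec (L ! i)) t) = 0"
      and i: "i \<le> m" for c :: "nat \<Rightarrow> real" and i
  proof (rule real_comb_zero[OF _ _ ind])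
    have *: "of_int (H (Suc i) (t, False)) = fst (rvec (L ! i)) t"
      "of_int (H (Suc i) (t, True)) = snd (rvec (L ! i)) t" if "i < m" for i t
      using that by (simp_all add: L_def rvec_def pvec_of_def)
    have "\<forall>u\<in>coords {..<n}. (\<Sum>i\<le>m. c i * real_of_int (H i u)) = 0"
      unfolding ball_coords using c
      by (simp add: sum.atMost_shift * H0 vec_of_def rvec_def[of e])
    then show "(\<Sum>i\<le>m. c i * real_of_int (H i u)) = 0" if "u \<in> D" for u
      using that by (simp add: D_def)
  qed (use i in \<open>auto simp: D_def\<close>)
  have "real_indep n L"
    unfolding real_indep_def len
  proof (intro allI impI)
    fix c :: "nat \<Rightarrow> real" and i
    assume "\<forall>t<n. (\<Sum>i<m. c i * fst (rvec (L ! i)) t) = 0 \<and> (\<Sum>i<m. c i * snd (rvec (L ! i)) t) = 0"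
      and "i < m"
    then show "c i = 0" using comb[of "\<lambda>i. if i = 0 then 0 else c (i - 1)" "Suc i"] by simp
  qed
  have "\<not> in_real_span n L (rvec e)"
  proof
    assume "in_real_span n L (rvec e)"
    then obtain c :: "nat \<Rightarrow> real" where "\<forall>t<n. fst (rvec e) t = (\<Sum>i<m. c i * fst (rvec (L ! i)) t) \<and>
        snd (rvec e) t = (\<Sum>i<m. c i * snd (rvec (L ! i)) t)"
      unfolding in_real_span_def len by blast
    then show False using comb[of "\<lambda>i. if i = 0 then -1 else c (i - 1)" 0] by simp
  qed
  then have ce: "cv_logical n L (rvec e)" using eL by (simp add: cv_logical_def sympl_rvec)
  have "d \<le> wt n v" if v: "cv_logical n L v" for v
  proof (rule ccontr)
    assume small: "\<not> d \<le> wt n v"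
    define T where "T = {t. t < n \<and> (fst v t \<noteq> 0 \<or> snd v t \<noteq> 0)}"
    have T: "T \<subseteq> {..<n}" "card T < d" using small by (auto simp: T_def wt_def)
    then have finT: "finite T" using finite_subset by blast
    obtain I where I: "I \<subseteq> {1..m}" "indep 0 I (coords T) H" "2 * card T \<le> card I"
      using rank T by blast
    \<comment> \<open>Twisting \<open>v\<close> turns its symplectic products with the rows into
      plain sums over coordinates.\<close>
    define w where "w = (\<lambda>(t, b). if b then fst v t else - snd v t)"
    have Hw: "(\<Sum>u\<in>coords T. w u * real_of_int (H i u)) = 0" if "i \<in> I" for i
    proof -
      obtain j where j: "i = Suc j" "j < m" using \<open>i \<in> I\<close> I by (cases i) auto
      have "L ! j \<in> set L" using j len by simp
      then have "0 = sympl n v (rvec (L ! j))" using v by (simp add: cv_logical_def)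
      also have "\<dots> = (\<Sum>t<n. fst v t * H i (t, True) - H i (t, False) * snd v t)"
        using j by (simp add: sympl_def rvec_def L_def pvec_of_def)
      also have "\<dots> = (\<Sum>t\<in>T. fst v t * H i (t, True) - H i (t, False) * snd v t)"
        by (rule sum.mono_neutral_right) (use T in \<open>auto simp: T_def\<close>)
      finally show ?thesis using finT by (simp add: sum_coords w_def algebra_simps)
    qed
    have "w u = 0" if "u \<in> coords T" for u
      by (rule full_rank_real_kernel[OF _ _ I(2) _ Hw that])
        (use I finT in \<open>auto simp: card_coords intro: finite_subset\<close>)
    then have "w (t, True) = 0" "w (t, False) = 0" if "t \<in> T" for t
      using that by (simp_all add: coords_def)
    then have "fst v t = 0 \<and> snd v t = 0" if "t \<in> T" for t
      using that by (simp add: w_def)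
    then have "\<forall>t<n. fst v t = 0 \<and> snd v t = 0" by (auto simp: T_def)
    then have "in_real_span n L v" by (auto simp: in_real_span_def intro!: exI[of _ "\<lambda>_. 0"])
    then show False using v by (simp add: cv_logical_def)
  qed
  then have "cv_distance n L d"
    unfolding cv_distance_def using ce e(2) wt_rvec by metis
  moreover have "k \<le> n" "length L = n - k"
    using assms(2) len unfolding is_stab_code_def m_def by simp_all
  ultimately have "cv_code_params n k d L"
    using \<open>real_indep n L\<close> isoL by (simp add: cv_code_params_def sympl_rvec)
  \<comment> \<open>The witness for \<open>d'\<close> is \<open>d\<close> itself: for this lift both
    distances equal the original one.\<close>
  then show ?thesis using LDI un by blast
qed

end
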